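(* Let $\omega$ be a non-quasianalytic weight function. Then $(\mathcal{S}_\omega(\mathbb{R}^N),\star)$ is a convolution topological algebra; that is, $f\star g\in\mathcal{S}_\omega(\mathbb{R}^N)$ for all $f,g\in\mathcal{S}_\omega(\mathbb{R}^N)$, and the bilinear map $\mathcal{S}_\omega(\mathbb{R}^N)\times\mathcal{S}_\omega(\mathbb{R}^N)\to\mathcal{S}_\omega(\mathbb{R}^N)$, $(f,g)\mapsto f\star g$, is (jointly) continuous, where $(f\star g)(x)=\int_{\mathbb{R}^N}f(y)g(x-y)\,dy$.
   Context: Weights. A non-quasianalytic weight function is a continuous increasing function $\omega:[0,\infty)\to[0,\infty)$ such that: ($\alpha$) there is $K\ge 1$ with $\omega(2t)\le K(1+\omega(t))$ for all $t\ge 0$; ($\beta$) $\int_1^\infty \frac{\omega(t)}{1+t^2}\,dt<\infty$; ($\gamma$) there are $a\in\mathbb{R}$, $b>0$ with $\omega(t)\ge a+b\log(1+t)$ for all $t\ge 0$; ($\delta$) $\varphi_\omega(t)=\omega(e^t)$ is convex. It is assumed (normalization) that $\omega$ vanishes on $[0,1]$. For $x\in\mathbb{R}^N$, $\omega(x):=\omega(|x|)$. The Young conjugate is $\varphi^*_\omega(s):=\sup_{t\ge 0}\{st-\varphi_\omega(t)\}$, $s\ge 0$ (the value $+\infty$ is allowed, with $\exp(-\infty)=0$). Space. $\mathcal{S}_\omega(\mathbb{R}^N)$ is the set of all $f\in L^1(\mathbb{R}^N)$ such that $f,\hat f\in C^\infty(\mathbb{R}^N)$ and $\|\exp(\lambda\omega)\partial^\alpha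 f\|_\infty<\infty$, $\|\exp(\lambda\omega)\partial^\alpha\hat f\|_\infty<\infty$ for all $\lambda>0$, $\alpha\in\mathbb{N}_0^N$ ($\hat f$ is the Fourier transform). It is a Fréchet space whose topology is generated by the norms $q_{m,n}(f):=\sup_{\alpha\in\mathbb{N}_0^N}\|\exp(n\omega)\partial^\alpha f\|_\infty\exp\left(-m\varphi^*_\omega\left(\frac{|\alpha|}{m}\right)\right)$, $m,n\in\mathbb{N}$ (these are finite on $\mathcal{S}_\omega(\mathbb{R}^N)$). *)

theory Defs
  imports "HOL-Analysis.Analysis"
begin

text \<open>
  Normalized non-quasianalytic weight functions. A weight is only relevant on \<open>{0..}\<close>;
  its values at negative arguments are arbitrary. ``Increasing'' means non-decreasing, as
  the normalization makes \<open>\<omega>\<close> constant on \<open>{0..1}\<close>.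
\<close>

definition nonquasianalytic_weight :: "(real \<Rightarrow> real) \<Rightarrow> bool" where
  "nonquasianalytic_weight \<omega> \<longleftrightarrow>
     continuous_on {0..} \<omega> \<and>
     mono_on {0..} \<omega> \<and>
     (\<forall>t\<ge>0. 0 \<le> \<omega> t) \<and>
     (\<exists>K\<ge>1. \<forall>t\<ge>0. \<omega> (2 * t) \<le> K * (1 + \<omega> t)) \<and>
     set_integrable lborel {1..} (\<lambda>t. \<omega> t / (1 + t\<^sup>2)) \<and>
     (\<exists>a b. b > 0 \<and> (\<forall>t\<ge>0. a + b * ln (1 + t) \<le> \<omega> t)) \<and>
     convex_on UNIV (\<lambda>t. \<omega> (exp t)) \<and>
     (\<forall>t\<in>{0..1}. \<omega> t = 0)"

definition young_conjugate :: "(real \<Rightarrow> real) \<Rightarrow> real \<Rightarrow> ereal" where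
  "young_conjugate \<omega> s = (SUP t\<in>{0..}. ereal (s * t - \<omega> (exp t)))"

definition exp_ereal :: "ereal \<Rightarrow> ennreal" where
  "exp_ereal y =
     (if y = \<infinity> then \<infinity> else if y = -\<infinity> then 0 else ennreal (exp (real_of_ereal y)))"

definition partial :: "'n::finite \<Rightarrow> (real ^ 'n \<Rightarrow> complex) \<Rightarrow> real ^ 'n \<Rightarrow> complex" where
  "partial i f x = vector_derivative (\<lambda>t. f (x + t *\<^sub>R axis i 1)) (at 0)"

text \<open>
  \<open>C\<^sup>\<infinity>\<close>: all iterated partial derivatives, in whatever order they are taken (the list
  \<open>is\<close>), exist and are continuous.
\<close>

definition smooth :: "(real ^ 'n::finite \<Rightarrow> complex) \<Rightarrow> bool" where
  "smooth f \<longleftrightarrow>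
     (\<forall>is. continuous_on UNIV (foldr partial is f) \<and>
        (\<forall>i x. (\<lambda>t. foldr partial is f (x + t *\<^sub>R axis i 1)) differentiable (at 0)))"

text \<open>
  The multi-index derivative \<open>\<partial>\<^sup>\<alpha>\<close>. The index type carries no order, so an arbitrary
  enumeration of the coordinates is fixed; it is only applied to smooth functions, for which
  the order is immaterial.
\<close>

definition coords :: "'n::finite list" where
  "coords = (SOME is. distinct is \<and> set is = UNIV)"

definition mderiv :: "('n::finite \<Rightarrow> nat) \<Rightarrow> (real ^ 'n \<Rightarrow> complex) \<Rightarrow> real ^ 'n \<Rightarrow> complex" where
  "mderiv \<alpha> f = foldr (\<lambda>i. partial i ^^ \<alpha> i) coords f"

definition fourier :: "(real ^ 'n::finite \<Rightarrow> complex) \<Rightarrow> real ^ 'n \<Rightarrow> complex" where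
  "fourier f \<xi> = (LINT x|lborel. f x * cis (- (x \<bullet> \<xi>)))"

definition wnorm :: "(real \<Rightarrow> real) \<Rightarrow> real \<Rightarrow> (real ^ 'n::finite \<Rightarrow> complex) \<Rightarrow> ennreal" where
  "wnorm \<omega> l F = (SUP x. ennreal (norm (exp (l * \<omega> (norm x)) *\<^sub>R F x)))"

definition S_space :: "(real \<Rightarrow> real) \<Rightarrow> (real ^ 'n::finite \<Rightarrow> complex) set" where
  "S_space \<omega> = {f. integrable lborel f \<and> smooth f \<and> smooth (fourier f) \<and>
     (\<forall>l>0. \<forall>\<alpha>. wnorm \<omega> l (mderiv \<alpha> f) < \<infinity> \<and> wnorm \<omega> l (mderiv \<alpha> (fourier f)) < \<infinity>)}"

definition qnorm :: "(real \<Rightarrow> real) \<Rightarrow> nat \<Rightarrow> nat \<Rightarrow> (real ^ 'n::finite \<Rightarrow> complex) \<Rightarrow> ennreal" where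
  "qnorm \<omega> m n f =
     (SUP \<alpha>. wnorm \<omega> (real n) (mderiv \<alpha> f) *
        exp_ereal (- (ereal (real m) * young_conjugate \<omega> (real (\<Sum>i\<in>UNIV. \<alpha> i) / real m))))"

text \<open>
  The locally convex topology of \<open>S_space \<omega>\<close>: the open balls of all the norms
  \<open>qnorm \<omega> m n\<close> with \<open>m, n \<ge> 1\<close> form a subbase.
\<close>

definition S_topology :: "(real \<Rightarrow> real) \<Rightarrow> (real ^ 'n::finite \<Rightarrow> complex) topology" where
  "S_topology \<omega> = topology_generated_by
     {{g \<in> S_space \<omega>. qnorm \<omega> m n (\<lambda>x. g x - f x) < ennreal \<epsilon>} | f m n \<epsilon>.
        f \<in> S_space \<omega> \<and> 1 \<le> m \<and> 1 \<le> n \<and> 0 < \<epsilon>}"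

lemma foldr_partial_zero: "foldr (\<lambda>i. partial i ^^ \<alpha> i) is (\<lambda>x. 0) = (\<lambda>x. 0)"
proof -
  have p: "partial i (\<lambda>x. 0) = (\<lambda>x. 0)" for i :: "'a::finite"
    by (simp add: partial_def fun_eq_iff)
  have "(partial i ^^ k) (\<lambda>x. 0) = (\<lambda>x. 0)" for i :: "'a::finite" and k
    by (induction k) (simp_all add: p)
  then show ?thesis
    by (induction "is") simp_all
qed

lemma topspace_S_topology:
  "topspace (S_topology \<omega>) = (S_space \<omega> :: (real ^ 'n::finite \<Rightarrow> complex) set)"
proof
  show "topspace (S_topology \<omega>) \<subseteq> (S_space \<omega> :: (real ^ 'n \<Rightarrow> complex) set)"
    unfolding S_topology_def topology_generated_by_topspace by blast
  show "(S_space \<omega> :: (real ^ 'n \<Rightarrow> complex) set) \<subseteq> topspace (S_topology \<omega>)"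
  proof
    fix f :: "real ^ 'n \<Rightarrow> complex" assume f: "f \<in> S_space \<omega>"
    let ?B = "{g \<in> S_space \<omega>. qnorm \<omega> 1 1 (\<lambda>x. g x - f x) < ennreal 1}"
    have "mderiv \<alpha> (\<lambda>x. f x - f x) = (\<lambda>x. 0)" for \<alpha>
      unfolding mderiv_def diff_self by (rule foldr_partial_zero)
    moreover have "wnorm \<omega> l (\<lambda>x :: real ^ 'n. 0) = 0" for l
      by (simp add: wnorm_def)
    ultimately have "qnorm \<omega> 1 1 (\<lambda>x. f x - f x) = 0"
      unfolding qnorm_def by (simp only: mult_zero_left) simp
    then have "f \<in> ?B"
      using f by (simp only: mem_Collect_eq) simp
    moreover have "?B \<in> {{g \<in> S_space \<omega>. qnorm \<omega> m n (\<lambda>x. g x - f x) < ennreal \<epsilon>} | f m n \<epsilon>.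
        f \<in> S_space \<omega> \<and> 1 \<le> m \<and> 1 \<le> n \<and> 0 < \<epsilon>}"
      unfolding mem_Collect_eq
      by (rule exI[of _ f], rule exI[of _ 1], rule exI[of _ 1], rule exI[of _ 1]) (use f in simp)
    ultimately show "f \<in> topspace (S_topology \<omega>)"
      unfolding S_topology_def topology_generated_by_topspace by (rule UnionI[rotated])
  qed
qed

definition convolution ::
  "(real ^ 'n::finite \<Rightarrow> complex) \<Rightarrow> (real ^ 'n \<Rightarrow> complex) \<Rightarrow> real ^ 'n \<Rightarrow> complex"
  (infixl "\<star>" 70) where
  "(f \<star> g) x = (LINT y|lborel. f y * g (x - y))"

definition bilinear_on ::
  "('a \<Rightarrow> complex) set \<Rightarrow> (('a \<Rightarrow> complex) \<Rightarrow> ('a \<Rightarrow> complex) \<Rightarrow> 'a \<Rightarrow> complex) \<Rightarrow> bool" where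
  "bilinear_on V B \<longleftrightarrow>
     (\<forall>f\<in>V. \<forall>g\<in>V. \<forall>h\<in>V. \<forall>a b.
        B (\<lambda>x. a * f x + b * g x) h = (\<lambda>x. a * B f h x + b * B g h x) \<and>
        B h (\<lambda>x. a * f x + b * g x) = (\<lambda>x. a * B h f x + b * B h g x))"

end

theory Submission
  imports Defs
begin

text \<open>
  By (\<open>\<alpha>\<close>), \<open>\<omega> x \<le> K (1 + \<omega> y + \<omega> (x - y))\<close>, and by (\<open>\<gamma>\<close>), \<open>exp (- \<mu> \<omega>)\<close> is integrable for some \<open>\<mu>\<close>.
  Since \<open>\<partial>\<^sup>\<alpha>(f \<star> g) = f \<star> \<partial>\<^sup>\<alpha>g\<close>, putting all derivatives on one factor gives
  \<open>q\<^sub>m\<^sub>,\<^sub>n(f \<star> g) \<le> C \<parallel>exp (N \<omega>) f\<parallel>\<^sub>\<infinity> q\<^sub>m\<^sub>,\<^sub>N(g)\<close>, where the sup norm is at most \<open>q\<^sub>m\<^sub>,\<^sub>N(f)\<close> because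
  \<open>\<phi>\<^sup>*(0) = 0\<close>. Applied to \<open>f \<star> g - f\<^sub>0 \<star> g\<^sub>0 = (f - f\<^sub>0) \<star> g + f\<^sub>0 \<star> (g - g\<^sub>0)\<close> this yields joint
  continuity. The Fourier side of membership is the product rule, since the Fourier transform turns
  \<open>\<star>\<close> into a pointwise product.
\<close>

subsection \<open>Symmetry of partial derivatives\<close>

text \<open>Only one of the two mixed derivatives is assumed to exist: differentiating
  \<open>F s b = F s a + integral {a..b} (Ft s)\<close> in \<open>s\<close> and then in \<open>b\<close> produces the other one.\<close>

lemma mixed_partial_swap:
  fixes F :: "real \<Rightarrow> real \<Rightarrow> 'c::banach"
  assumes Ft: "\<And>s t. (F s has_vector_derivative Ft s t) (at t)"
    and Fs: "\<And>s t. ((\<lambda>s. F s t) has_vector_derivative Fs s t) (at s)"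
    and Fts: "\<And>s t. ((\<lambda>s. Ft s t) has_vector_derivative Fts s t) (at s)"
    and cont: "continuous_on UNIV (\<lambda>(s, t). Fts s t)"
    and cont2: "\<And>s. continuous_on UNIV (Ft s)"
  shows "(Fs s has_vector_derivative Fts s t) (at t)"
proof -
  have int2: "Ft s integrable_on {a..b}" for s a b
    by (rule integrable_continuous_real) (rule continuous_on_subset[OF cont2], simp)
  have F_eq: "F s b = F s a + integral {a..b} (Ft s)" if "a \<le> b" for s a b
    using fundamental_theorem_of_calculus[of a b "F s" "Ft s", OF that] Ft
    by (simp add: has_vector_derivative_at_within integral_unique algebra_simps)
  have cont1: "continuous_on UNIV (Fts s)" for s
    using continuous_on_compose2[OF cont, of UNIV "\<lambda>t. (s, t)"]
    by (simp add: continuous_intros)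
  have Fs_eq: "Fs s b = Fs s a + integral {a..b} (Fts s)" if "a \<le> b" for s a b
  proof -
    \<comment> \<open>Differentiation under the integral sign; joint continuity of
      \<open>Fts\<close> enters here. The formula for \<open>Fs\<close> then follows from uniqueness
      of derivatives.\<close>
    have "((\<lambda>s. integral (cbox a b) (Ft s)) has_vector_derivative integral (cbox a b) (Fts s))
        (at s within UNIV)"
      by (rule leibniz_rule_vector_derivative)
        (use int2 Fts in \<open>auto intro: continuous_on_subset[OF cont] has_vector_derivative_at_within\<close>)
    then have "((\<lambda>s. F s a + integral {a..b} (Ft s)) has_vector_derivative
        Fs s a + integral {a..b} (Fts s)) (at s)"
      by (intro has_vector_derivative_add Fs) simp
    then have "((\<lambda>s. F s b) has_vector_derivative Fs s a + integral {a..b} (Fts s)) (at s)"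
      using F_eq[OF that] by simp
    with Fs[of b s] show ?thesis
      using vector_derivative_unique_at by blast
  qed
  \<comment> \<open>Starting the integral at \<open>t - 1\<close> makes \<open>t\<close> an interior
    point of the interval, so the derivative within the interval becomes a full derivative.\<close>
  have "((\<lambda>u. integral {t - 1..u} (Fts s)) has_vector_derivative Fts s t)
      (at t within {t - 1..t + 1})"
    by (rule integral_has_vector_derivative) (auto intro: continuous_on_subset[OF cont1])
  then have "((\<lambda>u. Fs s (t - 1) + integral {t - 1..u} (Fts s)) has_vector_derivative Fts s t)
      (at t within {t - 1..t + 1})"
    by (simp only: add.commute[of "Fs s (t - 1)"] has_vector_derivative_add_const)
  then have "(Fs s has_vector_derivative Fts s t) (at t within {t - 1..t + 1})"
    by (rule has_vector_derivative_transform[rotated 2]) (auto intro: Fs_eq)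
  moreover have "at t within {t - 1..t + 1} = at t"
    by (rule at_within_interior) simp
  ultimately show ?thesis
    by simp
qed

section \<open>Smooth functions along coordinate lines\<close>

lemma has_vector_derivative_iff_quotient:
  "(f has_vector_derivative D) (at a) \<longleftrightarrow> ((\<lambda>t. (f t - f a) /\<^sub>R (t - a)) \<longlongrightarrow> D) (at a)"
proof -
  have "norm ((f t - f a) - (t - a) *\<^sub>R D) / norm (t - a) = norm ((f t - f a) /\<^sub>R (t - a) - D)"
    if "t \<noteq> a" for t
  proof -
    have "(f t - f a) - (t - a) *\<^sub>R D = (t - a) *\<^sub>R ((f t - f a) /\<^sub>R (t - a) - D)"
      using that by (simp add: scaleR_diff_right)
    then show ?thesis
      using that by simp
  qed
  then have "((\<lambda>t. norm ((f t - f a) - (t - a) *\<^sub>R D) / norm (t - a)) \<longlongrightarrow> 0) (at a) \<longleftrightarrow>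
      ((\<lambda>t. norm ((f t - f a) /\<^sub>R (t - a) - D)) \<longlongrightarrow> 0) (at a)"
    by (intro Lim_cong_within) auto
  then show ?thesis
    unfolding has_vector_derivative_def has_derivative_iff_norm
    by (simp add: bounded_linear_scaleR_left tendsto_norm_zero_iff LIM_zero_iff)
qed

lemma smooth_foldr:
  assumes "smooth f"
  shows "smooth (foldr partial js f)"
  using assms unfolding smooth_def by (metis foldr_append o_apply)

lemma smooth_partial: "smooth f \<Longrightarrow> smooth (partial i f)"
  using smooth_foldr[of f "[i]"] by simp

lemma smooth_continuous: "smooth f \<Longrightarrow> continuous_on UNIV f"
  unfolding smooth_def by (metis foldr.simps(1) id_apply)

text \<open>\<open>smooth\<close> and \<open>partial\<close> only speak of parameter 0. Moving the
  base point along the line gives the derivative at every parameter, as the mean value inequality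
  and the swap of partials require.\<close>

lemma smooth_line_derivative:
  assumes "smooth f"
  shows "((\<lambda>t. f (x + t *\<^sub>R axis i 1)) has_vector_derivative partial i f (x + t *\<^sub>R axis i 1)) (at t)"
proof -
  have "(\<lambda>u. f ((x + t *\<^sub>R axis i 1) + u *\<^sub>R axis i 1)) differentiable (at 0)"
    using assms unfolding smooth_def by (metis foldr.simps(1) id_apply)
  then have "((\<lambda>u. f ((x + t *\<^sub>R axis i 1) + u *\<^sub>R axis i 1)) has_vector_derivative
      partial i f (x + t *\<^sub>R axis i 1)) (at 0)"
    unfolding partial_def by (simp add: vector_derivative_works)
  then have "((\<lambda>u. f (x + (t + u) *\<^sub>R axis i 1)) has_vector_derivative
      partial i f (x + t *\<^sub>R axis i 1)) (at 0)"
    by (simp add: algebra_simps)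
  then have "(((\<lambda>u. f (x + (t + u) *\<^sub>R axis i 1)) \<circ> (\<lambda>s. s - t)) has_vector_derivative
      1 *\<^sub>R partial i f (x + t *\<^sub>R axis i 1)) (at t)"
    by (intro vector_diff_chain_at) (auto intro!: derivative_eq_intros)
  then show ?thesis
    by (simp add: o_def)
qed

lemma partial_eqI:
  "((\<lambda>t. f (x + t *\<^sub>R axis i 1)) has_vector_derivative D) (at 0) \<Longrightarrow> partial i f x = D"
  unfolding partial_def by (rule vector_derivative_at)

text \<open>Apply \<open>mixed_partial_swap\<close> to the restriction of \<open>f\<close> to the
  plane through \<open>x\<close> spanned by the directions \<open>i\<close> and \<open>j\<close>,
  where smoothness supplies the continuity of the mixed derivative.\<close>

lemma partial_commute:
  assumes "smooth f"
  shows "partial i (partial j f) = partial j (partial i f)"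
proof
  fix x :: "real ^ 'a"
  let ?p = "\<lambda>s t. x + s *\<^sub>R axis i 1 + t *\<^sub>R axis j 1"
  have swap: "x + t *\<^sub>R axis j 1 + s *\<^sub>R axis i 1 = ?p s t" for s t
    by simp
  have "((\<lambda>t. partial i f (?p 0 t)) has_vector_derivative partial i (partial j f) (?p 0 0)) (at 0)"
  proof (rule mixed_partial_swap[where F = "\<lambda>s t. f (?p s t)"
        and Ft = "\<lambda>s t. partial j f (?p s t)" and Fs = "\<lambda>s t. partial i f (?p s t)"
        and Fts = "\<lambda>s t. partial i (partial j f) (?p s t)"])
    show "((\<lambda>t. f (?p s t)) has_vector_derivative partial j f (?p s t)) (at t)" for s t
      by (rule smooth_line_derivative[OF assms])
    show "((\<lambda>s. f (?p s t)) has_vector_derivative partial i f (?p s t)) (at s)" for s t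
      using smooth_line_derivative[OF assms, of "x + t *\<^sub>R axis j 1" i s] unfolding swap .
    show "((\<lambda>s. partial j f (?p s t)) has_vector_derivative partial i (partial j f) (?p s t)) (at s)"
      for s t
      using smooth_line_derivative[OF smooth_partial[OF assms], of j "x + t *\<^sub>R axis j 1" i s]
      unfolding swap .
    show "continuous_on UNIV (\<lambda>(s, t). partial i (partial j f) (?p s t))"
      unfolding split_beta
      by (rule continuous_on_compose2[OF smooth_continuous[OF smooth_partial[OF smooth_partial[OF assms]]]])
        (auto intro!: continuous_intros)
    show "continuous_on UNIV (\<lambda>t. partial j f (?p s t))" for s
      by (rule continuous_on_compose2[OF smooth_continuous[OF smooth_partial[OF assms]]])
        (auto intro!: continuous_intros)
  qed
  then show "partial i (partial j f) x = partial j (partial i f) x"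
    by (intro partial_eqI[symmetric]) simp
qed

section \<open>Multi-index derivatives as iterated derivatives along lists\<close>

lemma foldr_partial_permute:
  assumes "smooth f" "mset xs = mset ys"
  shows "foldr partial xs f = foldr partial ys f"
proof -
  \<comment> \<open>The partials commute only on smooth functions, so the permutation is carried out
    with smoothness as an invariant of the fold.\<close>
  have "List.fold partial (rev xs) f = List.fold partial (rev ys) f"
    by (rule fold_permuted_eq[where P = smooth]) (auto simp: assms smooth_partial partial_commute)
  then show ?thesis
    by (simp add: foldr_conv_fold)
qed

text \<open>The multi-index written out as a list with multiplicities, in the order that
  \<open>mderiv\<close> uses. Facts about \<open>foldr partial\<close> then cover multi-indices as
  well.\<close>

definition indices :: "('n::finite \<Rightarrow> nat) \<Rightarrow> 'n list" where
  "indices \<alpha> = concat (map (\<lambda>i. replicate (\<alpha> i) i) coords)"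

lemma foldr_replicate: "foldr f (replicate k i) = f i ^^ k"
  by (induction k) auto

lemma mderiv_eq_foldr: "mderiv \<alpha> f = foldr partial (indices \<alpha>) f"
proof -
  have "foldr (\<lambda>i. partial i ^^ \<alpha> i) is f = foldr partial (concat (map (\<lambda>i. replicate (\<alpha> i) i) is)) f"
    for "is"
    by (induction "is") (auto simp: foldr_replicate)
  then show ?thesis
    unfolding mderiv_def indices_def .
qed

lemma coords: "distinct (coords :: 'n::finite list)" "set (coords :: 'n list) = UNIV"
proof -
  have "\<exists>is :: 'n list. distinct is \<and> set is = UNIV"
    using finite_distinct_list[of "UNIV :: 'n set"] by auto
  then have "distinct (coords :: 'n list) \<and> set (coords :: 'n list) = UNIV"
    unfolding coords_def by (rule someI_ex)
  then show "distinct (coords :: 'n list)" "set (coords :: 'n list) = UNIV"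
    by auto
qed

lemma mset_indices: fixes "is" :: "'a::finite list" shows "mset (indices (count (mset is))) = mset is"
proof (rule multiset_eqI)
  fix j :: 'a
  \<comment> \<open>Distinctness lets each coordinate contribute exactly one block of
    copies.\<close>
  have *: "count (mset (concat (map (\<lambda>i. replicate (\<alpha> i) i) js))) j = (if j \<in> set js then \<alpha> j else 0)"
    if "distinct js" for js and \<alpha> :: "'a \<Rightarrow> nat"
    using that by (induction js) auto
  show "count (mset (indices (count (mset is)))) j = count (mset is) j"
    unfolding indices_def by (subst *) (auto simp: coords)
qed

text \<open>By symmetry only the multiplicities in the list matter. Bounds stated for multi-indices
  thus hold for derivatives taken in any order.\<close>

lemma foldr_partial_eq_mderiv:
  assumes "smooth f"
  shows "foldr partial is f = mderiv (count (mset is)) f"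
  unfolding mderiv_eq_foldr
  by (rule foldr_partial_permute[OF assms]) (simp add: mset_indices)

subsection \<open>Convolution and Fourier transform\<close>

lemma lborel_reflect:
  fixes x :: "'a::euclidean_space"
  shows "distr lborel borel (\<lambda>y. x - y) = lborel"
  using lborel_affine[of "-1" x] by (simp add: density_1 one_ennreal_def[symmetric])

lemma lborel_shift:
  fixes x :: "'a::euclidean_space"
  shows "distr lborel borel (\<lambda>y. y - x) = lborel"
  using lborel_affine[of 1 "- x"] by (simp add: density_1 one_ennreal_def[symmetric])

lemma integral_reflect:
  fixes f :: "'a::euclidean_space \<Rightarrow> 'b::{banach, second_countable_topology}"
  assumes [measurable]: "f \<in> borel_measurable borel"
  shows "(LINT y|lborel. f (x - y)) = (LINT y|lborel. f y)"
  by (subst (2) lborel_reflect[of x, symmetric]) (simp add: integral_distr)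

lemma integral_shift:
  fixes f :: "'a::euclidean_space \<Rightarrow> 'b::{banach, second_countable_topology}"
  assumes [measurable]: "f \<in> borel_measurable borel"
  shows "(LINT y|lborel. f (y - x)) = (LINT y|lborel. f y)"
  by (subst (2) lborel_shift[of x, symmetric]) (simp add: integral_distr)

lemma integrable_shift:
  fixes f :: "'a::euclidean_space \<Rightarrow> 'b::{banach, second_countable_topology}"
  assumes "integrable lborel f"
  shows "integrable lborel (\<lambda>y. f (y - x))"
proof -
  have [measurable]: "f \<in> borel_measurable borel"
    using borel_measurable_integrable[OF assms] by simp
  show ?thesis
    using assms by (subst (asm) lborel_shift[of x, symmetric]) (simp add: integrable_distr_eq)
qed

section \<open>Convolution of an integrable function with a bounded one\<close>

lemma convolution_commute:
  assumes "f \<in> borel_measurable borel" "g \<in> borel_measurable borel"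
  shows "f \<star> g = g \<star> f"
proof
  fix x
  note [measurable] = assms
  show "(f \<star> g) x = (g \<star> f) x"
    unfolding convolution_def
    using integral_reflect[of "\<lambda>y. f y * g (x - y)" x] by (simp add: mult.commute)
qed

lemma convolution_integrable:
  fixes h g :: "real ^ 'n::finite \<Rightarrow> complex"
  assumes "integrable lborel h" and [measurable]: "g \<in> borel_measurable borel"
    and "\<And>x. norm (g x) \<le> B"
  shows "integrable lborel (\<lambda>y. h y * g (x - y))"
proof (rule Bochner_Integration.integrable_bound)
  show "integrable lborel (\<lambda>y. norm (h y) * B)"
    using assms(1) by simp
  show "(\<lambda>y. h y * g (x - y)) \<in> borel_measurable lborel"
    using borel_measurable_integrable[OF assms(1)] by measurable
  have B: "norm (g x) \<le> \<bar>B\<bar>" for x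
    using assms(3)[of x] by linarith
  show "AE y in lborel. norm (h y * g (x - y)) \<le> norm (norm (h y) * B)"
    using B by (intro AE_I2) (simp add: abs_mult norm_mult mult_left_mono)
qed

text \<open>Dominated convergence with majorant \<open>B * norm (h y)\<close>. It serves both
  continuity of the convolution and differentiation under the integral sign.\<close>

lemma convolution_tendsto:
  fixes G :: "nat \<Rightarrow> real ^ 'n::finite \<Rightarrow> complex"
  assumes h: "integrable lborel h" and [measurable]: "\<And>k. G k \<in> borel_measurable borel"
    "g \<in> borel_measurable borel"
    and B: "\<And>k x. norm (G k x) \<le> B" and lim: "\<And>x. (\<lambda>k. G k x) \<longlonglongrightarrow> g x"
  shows "(\<lambda>k. LINT y|lborel. h y * G k y) \<longlonglongrightarrow> (LINT y|lborel. h y * g y)"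
proof (rule integral_dominated_convergence)
  note [measurable] = borel_measurable_integrable[OF h]
  show "integrable lborel (\<lambda>y. norm (h y) * B)"
    using h by simp
  show "(\<lambda>y. h y * g y) \<in> borel_measurable lborel" "(\<lambda>y. h y * G k y) \<in> borel_measurable lborel" for k
    by measurable
  show "AE y in lborel. (\<lambda>k. h y * G k y) \<longlonglongrightarrow> h y * g y"
    by (intro AE_I2 tendsto_mult tendsto_const lim)
  show "AE y in lborel. norm (h y * G k y) \<le> norm (h y) * B" for k
    using B by (intro AE_I2) (simp add: norm_mult mult_left_mono)
qed

lemma convolution_continuous:
  fixes h g :: "real ^ 'n::finite \<Rightarrow> complex"
  assumes h: "integrable lborel h" and g: "continuous_on UNIV g" and B: "\<And>x. norm (g x) \<le> B"
  shows "continuous_on UNIV (h \<star> g)"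
  unfolding continuous_on_sequentially o_def
proof safe
  fix u :: "nat \<Rightarrow> real ^ 'n" and x assume u: "u \<longlonglongrightarrow> x"
  have [measurable]: "g \<in> borel_measurable borel"
    by (rule borel_measurable_continuous_onI[OF g])
  show "(\<lambda>k. (h \<star> g) (u k)) \<longlonglongrightarrow> (h \<star> g) x"
    unfolding convolution_def
  proof (rule convolution_tendsto[OF h, where B = B])
    show "(\<lambda>k. g (u k - y)) \<longlonglongrightarrow> g (x - y)" for y
      by (rule continuous_on_tendsto_compose[OF g]) (auto intro!: tendsto_intros u)
  qed (auto intro: B)
qed

text \<open>The mean value inequality on a coordinate line. It bounds difference quotients of
  \<open>g\<close> uniformly, which is the domination needed for differentiating a
  convolution.\<close>

lemma smooth_line_lipschitz:
  assumes "smooth g" and B: "\<And>x. norm (partial i g x) \<le> B"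
  shows "norm (g (x + t *\<^sub>R axis i 1) - g x) \<le> B * \<bar>t\<bar>"
proof -
  have "norm (g (x + t *\<^sub>R axis i 1) - g (x + 0 *\<^sub>R axis i 1)) \<le> B * norm (t - 0)"
  proof (rule differentiable_bound[where S = UNIV])
    show "((\<lambda>t. g (x + t *\<^sub>R axis i 1)) has_derivative
        (\<lambda>s. s *\<^sub>R partial i g (x + r *\<^sub>R axis i 1))) (at r within UNIV)" for r
      using smooth_line_derivative[OF assms(1)] unfolding has_vector_derivative_def by simp
    show "onorm (\<lambda>s. s *\<^sub>R partial i g (x + r *\<^sub>R axis i 1)) \<le> B" for r
      by (rule onorm_le) (simp add: B mult.commute[of B] mult_left_mono)
  qed auto
  then show ?thesis
    by simp
qed

text \<open>Reduces a derivative to sequences, the form in which dominated convergence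
  applies.\<close>

lemma has_vector_derivative_sequentiallyI:
  assumes "\<And>u. (\<And>k. u k \<noteq> 0) \<Longrightarrow> u \<longlonglongrightarrow> 0 \<Longrightarrow> (\<lambda>k. (f (u k) - f 0) /\<^sub>R u k) \<longlonglongrightarrow> D"
  shows "(f has_vector_derivative D) (at (0::real))"
  unfolding has_vector_derivative_iff_quotient tendsto_at_iff_sequentially
  using assms by (auto simp: o_def)

text \<open>The difference quotient of \<open>h \<star> g\<close> is the integral of
  \<open>h\<close> against difference quotients of \<open>g\<close>. These converge pointwise to
  \<open>partial i g\<close> and are bounded by \<open>B'\<close>.\<close>

lemma convolution_line_derivative:
  assumes h: "integrable lborel h" and g: "smooth g"
    and B: "\<And>x. norm (g x) \<le> B" and B': "\<And>x. norm (partial i g x) \<le> B'"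
  shows "((\<lambda>t. (h \<star> g) (x + t *\<^sub>R axis i 1)) has_vector_derivative (h \<star> partial i g) x) (at 0)"
proof (rule has_vector_derivative_sequentiallyI)
  fix u :: "nat \<Rightarrow> real" assume u0: "\<And>k. u k \<noteq> 0" and u: "u \<longlonglongrightarrow> 0"
  let ?D = "\<lambda>k y. (g (x - y + u k *\<^sub>R axis i 1) - g (x - y)) /\<^sub>R u k"
  have [measurable]: "g \<in> borel_measurable borel" "partial i g \<in> borel_measurable borel"
    by (intro borel_measurable_continuous_onI smooth_continuous smooth_partial g)+
  have "(\<lambda>k. LINT y|lborel. h y * ?D k y) \<longlonglongrightarrow> (LINT y|lborel. h y * partial i g (x - y))"
  proof (rule convolution_tendsto[OF h, where B = B'])
    show "norm (?D k y) \<le> B'" for k y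
      using smooth_line_lipschitz[OF g B', of "x - y" "u k"] u0[of k]
      by (simp add: divide_simps mult.commute)
    show "(\<lambda>k. ?D k y) \<longlonglongrightarrow> partial i g (x - y)" for y
    proof -
      have "((\<lambda>t. (g (x - y + t *\<^sub>R axis i 1) - g (x - y)) /\<^sub>R t) \<longlongrightarrow> partial i g (x - y)) (at 0)"
        using smooth_line_derivative[OF g, of "x - y" i 0]
        by (simp add: has_vector_derivative_iff_quotient)
      then show ?thesis
        unfolding tendsto_at_iff_sequentially using u u0 by (auto simp: o_def)
    qed
  qed auto
  moreover have "(LINT y|lborel. h y * ?D k y) =
      ((h \<star> g) (x + u k *\<^sub>R axis i 1) - (h \<star> g) (x + 0 *\<^sub>R axis i 1)) /\<^sub>R u k" for k
  proof -
    have "(h \<star> g) (x + u k *\<^sub>R axis i 1) - (h \<star> g) x =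
        (LINT y|lborel. h y * g (x + u k *\<^sub>R axis i 1 - y) - h y * g (x - y))"
      unfolding convolution_def
      by (rule Bochner_Integration.integral_diff[symmetric]; rule convolution_integrable[OF h _ B]) auto
    also have "\<dots> /\<^sub>R u k = (LINT y|lborel. h y * ?D k y)"
      by (subst integral_scaleR_right[symmetric])
        (intro Bochner_Integration.integral_cong refl, simp add: algebra_simps)
    finally show ?thesis
      unfolding scaleR_zero_left add_0_right by (rule sym)
  qed
  ultimately show "(\<lambda>k. ((h \<star> g) (x + u k *\<^sub>R axis i 1) - (h \<star> g) (x + 0 *\<^sub>R axis i 1)) /\<^sub>R u k)
      \<longlonglongrightarrow> (h \<star> partial i g) x"
    by (simp only: convolution_def)
qed

text \<open>Induction on the list: boundedness of every iterated derivative of \<open>g\<close>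
  allows differentiating under the integral once more at each step, always on the second
  factor.\<close>

lemma
  assumes h: "integrable lborel h" and g: "smooth g"
    and B: "\<And>is. \<exists>B. \<forall>x. norm (foldr partial is g x) \<le> B"
  shows foldr_partial_convolution: "foldr partial is (h \<star> g) = h \<star> foldr partial is g"
    and smooth_convolution: "smooth (h \<star> g)"
proof -
  have der: "((\<lambda>t. (h \<star> foldr partial is g) (x + t *\<^sub>R axis i 1)) has_vector_derivative
      (h \<star> partial i (foldr partial is g)) x) (at 0)" for "is" i x
  proof -
    obtain B1 B2 where "\<And>x. norm (foldr partial is g x) \<le> B1"
      "\<And>x. norm (foldr partial (i # is) g x) \<le> B2"
      using B by metis
    then show ?thesis
      by (intro convolution_line_derivative[OF h smooth_foldr[OF g], where B = B1 and B' = B2]) auto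
  qed
  show eq: "foldr partial is (h \<star> g) = h \<star> foldr partial is g" for "is"
  proof (induction "is")
    case (Cons i "is")
    show ?case
      using partial_eqI[OF der[of "is"]] by (simp add: Cons fun_eq_iff)
  qed simp
  show "smooth (h \<star> g)"
    unfolding smooth_def eq
  proof safe
    fix "is" i x
    show "continuous_on UNIV (h \<star> foldr partial is g)"
      using B[of "is"] convolution_continuous[OF h smooth_continuous[OF smooth_foldr[OF g]]] by blast
    show "(\<lambda>t. (h \<star> foldr partial is g) (x + t *\<^sub>R axis i 1)) differentiable at 0"
      using der[of "is"] by (rule differentiableI_vector)
  qed
qed

section \<open>The Fourier transform of a convolution\<close>

lemma fourier_convolution:
  assumes f: "integrable lborel f" and g: "integrable lborel g"
  shows "fourier (f \<star> g) = (\<lambda>\<xi>. fourier f \<xi> * fourier g \<xi>)"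
proof
  fix \<xi> :: "real ^ 'a"
  have [measurable]: "f \<in> borel_measurable borel" "g \<in> borel_measurable borel"
    using f g borel_measurable_integrable by auto
  have [measurable]: "(\<lambda>x. cis (- (x \<bullet> \<xi>))) \<in> borel_measurable borel"
    by (intro borel_measurable_continuous_onI continuous_intros)
  let ?H = "\<lambda>y x. f y * g (x - y) * cis (- (x \<bullet> \<xi>))"
  have int_x: "integrable lborel (\<lambda>x. ?H y x)" for y
  proof (rule Bochner_Integration.integrable_bound)
    show "integrable lborel (\<lambda>x. f y * g (x - y))"
      using integrable_shift[OF g] by simp
  qed (auto simp: norm_mult)
  have "integrable (lborel \<Otimes>\<^sub>M lborel) (case_prod ?H)"
  proof (rule lborel_pair.Fubini_integrable)
    show "case_prod ?H \<in> borel_measurable (lborel \<Otimes>\<^sub>M lborel)"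
      by measurable
    \<comment> \<open>Translation invariance turns the inner integral into a constant multiple of
      \<open>norm (f y)\<close>, which gives the absolute integrability for Fubini.\<close>
    have "(LINT x|lborel. norm (?H y x)) = norm (f y) * (LINT x|lborel. norm (g x))" for y
      using integral_shift[of "\<lambda>x. norm (g x)" y] by (simp add: norm_mult)
    then show "integrable lborel (\<lambda>y. LINT x|lborel. norm (case (y, x) of (y, x) \<Rightarrow> ?H y x))"
      using f by simp
    show "AE y in lborel. integrable lborel (\<lambda>x. case (y, x) of (y, x) \<Rightarrow> ?H y x)"
      using int_x by simp
  qed
  then have "(LINT x|lborel. LINT y|lborel. ?H y x) = (LINT y|lborel. LINT x|lborel. ?H y x)"
    by (rule lborel_pair.Fubini_integral)
  also have "(\<lambda>y. LINT x|lborel. ?H y x) = (\<lambda>y. f y * cis (- (y \<bullet> \<xi>)) * fourier g \<xi>)"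
  proof
    fix y
    \<comment> \<open>The character is multiplicative, so \<open>x = y + (x - y)\<close> splits it
      into one factor for \<open>f\<close> and one for \<open>g\<close>.\<close>
    have "(LINT x|lborel. ?H y x) = (LINT x|lborel. f y * cis (- (y \<bullet> \<xi>)) *
        (g (x - y) * cis (- ((x - y) \<bullet> \<xi>))))"
      by (intro Bochner_Integration.integral_cong) (auto simp: cis_mult algebra_simps inner_diff_left)
    also have "\<dots> = f y * cis (- (y \<bullet> \<xi>)) * (LINT x|lborel. g (x - y) * cis (- ((x - y) \<bullet> \<xi>)))"
      by simp
    also have "(LINT x|lborel. g (x - y) * cis (- ((x - y) \<bullet> \<xi>))) = fourier g \<xi>"
      unfolding fourier_def by (rule integral_shift[of "\<lambda>x. g x * cis (- (x \<bullet> \<xi>))"]) measurable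
    finally show "(LINT x|lborel. ?H y x) = f y * cis (- (y \<bullet> \<xi>)) * fourier g \<xi>" .
  qed
  also have "(LINT y|lborel. f y * cis (- (y \<bullet> \<xi>)) * fourier g \<xi>) = fourier f \<xi> * fourier g \<xi>"
    unfolding fourier_def by simp
  also have "(\<lambda>x. LINT y|lborel. ?H y x) = (\<lambda>x. (f \<star> g) x * cis (- (x \<bullet> \<xi>)))"
    unfolding convolution_def by simp
  finally show "fourier (f \<star> g) \<xi> = fourier f \<xi> * fourier g \<xi>"
    unfolding fourier_def .
qed

subsection \<open>Weights\<close>

lemma weight_nonneg: "nonquasianalytic_weight \<omega> \<Longrightarrow> 0 \<le> \<omega> (norm x)"
  by (simp add: nonquasianalytic_weight_def)

lemma weight_continuous:
  assumes "nonquasianalytic_weight \<omega>"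
  shows "continuous_on UNIV (\<lambda>x :: real ^ 'n::finite. \<omega> (norm x))"
  by (rule continuous_on_compose2[of "{0..}" \<omega>])
    (use assms in \<open>auto simp: nonquasianalytic_weight_def intro!: continuous_intros\<close>)

text \<open>The norm of \<open>x\<close> is at most twice the larger of the norms of
  \<open>y\<close> and \<open>x - y\<close>. Monotonicity and (\<alpha>) bound the weight through
  that maximum, and a maximum of nonnegative numbers is at most their sum.\<close>

lemma weight_quasi_subadditive:
  assumes "nonquasianalytic_weight \<omega>"
  obtains K where "K \<ge> 1"
    "\<And>x y :: 'a::real_normed_vector. \<omega> (norm x) \<le> K * (1 + \<omega> (norm y) + \<omega> (norm (x - y)))"
proof -
  from assms obtain K where K: "K \<ge> 1" "\<And>t. t \<ge> 0 \<Longrightarrow> \<omega> (2 * t) \<le> K * (1 + \<omega> t)"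
    unfolding nonquasianalytic_weight_def by blast
  have mono: "\<omega> s \<le> \<omega> t" if "0 \<le> s" "s \<le> t" for s t
    using assms that unfolding nonquasianalytic_weight_def mono_on_def by auto
  have "\<omega> (norm x) \<le> K * (1 + \<omega> (norm y) + \<omega> (norm (x - y)))" for x y :: 'a
  proof -
    let ?m = "max (norm y) (norm (x - y))"
    have "norm x \<le> 2 * ?m"
      using norm_triangle_ineq[of y "x - y"] by simp
    then have "\<omega> (norm x) \<le> K * (1 + \<omega> ?m)"
      using mono[of "norm x" "2 * ?m"] K(2)[of ?m] by (simp add: le_max_iff_disj)
    also have "\<omega> ?m \<le> \<omega> (norm y) + \<omega> (norm (x - y))"
      using weight_nonneg[OF assms, of y] weight_nonneg[OF assms, of "x - y"] by (simp add: max_def)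
    then have "K * (1 + \<omega> ?m) \<le> K * (1 + \<omega> (norm y) + \<omega> (norm (x - y)))"
      using K(1) by simp
    finally show ?thesis .
  qed
  with K(1) that show ?thesis
    by blast
qed

text \<open>Dominate the function by a series of multiples of indicators of balls of radius
  \<open>k + 1\<close>. Their volumes grow like the power \<open>DIM('a)\<close> of the radius, so
  the two extra powers leave the convergent series of \<open>1 / (k + 1)^2\<close>.\<close>

lemma integrable_inverse_power_norm:
  "integrable lborel (\<lambda>x :: 'a::euclidean_space. inverse ((1 + norm x) ^ (DIM('a) + 2)))"
proof (rule integrableI_bounded)
  let ?d = "DIM('a)" and ?c = "unit_ball_vol (real DIM('a))"
  let ?f = "\<lambda>x :: 'a. inverse ((1 + norm x) ^ (?d + 2))"
  let ?g = "\<lambda>k x :: 'a. ennreal (inverse (real (Suc k) ^ (?d + 2))) * indicator (ball 0 (real (Suc k))) x"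
  show "?f \<in> borel_measurable lborel"
    by simp
  have term_le: "u k \<le> (\<Sum>k. u k)" for u :: "nat \<Rightarrow> ennreal" and k
    using sum_le_suminf[of u "{k}"] by simp
  have le: "ennreal (norm (?f x)) \<le> (\<Sum>k. ?g k x)" for x
  proof -
    \<comment> \<open>The shell containing \<open>x\<close>: the single term of index
      \<open>k\<close> already dominates the function there.\<close>
    define k where "k = nat \<lfloor>norm x\<rfloor>"
    have k: "real k \<le> norm x" "norm x < real (Suc k)"
      unfolding k_def by (simp add: of_nat_floor) (simp; linarith)
    have "norm (?f x) \<le> inverse (real (Suc k) ^ (?d + 2))"
      using k by (simp only: norm_inverse norm_power) (intro le_imp_inverse_le power_mono; simp)
    then have "ennreal (norm (?f x)) \<le> ?g k x"
      using k by (simp add: ennreal_leI)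
    also have "\<dots> \<le> (\<Sum>k. ?g k x)"
      by (rule term_le)
    finally show ?thesis .
  qed
  have "(\<integral>\<^sup>+x. ennreal (norm (?f x)) \<partial>lborel) \<le> (\<integral>\<^sup>+x. (\<Sum>k. ?g k x) \<partial>lborel)"
    by (rule nn_integral_mono) (rule le)
  also have "\<dots> = (\<Sum>k. \<integral>\<^sup>+x. ?g k x \<partial>lborel)"
    by (intro nn_integral_suminf borel_measurable_times_ennreal borel_measurable_const
      borel_measurable_indicator) simp
  also have "(\<lambda>k. \<integral>\<^sup>+x. ?g k x \<partial>lborel) = (\<lambda>k. ennreal (?c * (1 / real (Suc k) ^ 2)))"
  proof
    fix k
    have "(\<integral>\<^sup>+x. ?g k x \<partial>lborel) =
        ennreal (inverse (real (Suc k) ^ (?d + 2))) * ennreal (?c * real (Suc k) ^ ?d)"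
      by (subst nn_integral_cmult_indicator) (simp_all add: emeasure_ball del: of_nat_Suc)
    also have "\<dots> = ennreal (?c * (1 / real (Suc k) ^ 2))"
      by (simp add: ennreal_mult'[symmetric] power_add power2_eq_square field_simps del: of_nat_Suc)
    finally show "(\<integral>\<^sup>+x. ?g k x \<partial>lborel) = ennreal (?c * (1 / real (Suc k) ^ 2))" .
  qed
  also have "(\<Sum>k. ennreal (?c * (1 / real (Suc k) ^ 2))) < \<infinity>"
  proof -
    have "summable (\<lambda>k. ?c * (1 / real (Suc k) ^ 2))"
      using inverse_power_summable[of 2, where 'a = real] summable_Suc_iff[of "\<lambda>k. inverse (real k ^ 2)"]
      by (intro summable_mult) (simp add: inverse_eq_divide)
    then show ?thesis
      by (subst suminf_ennreal2) (auto simp: unit_ball_vol_nonneg)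
  qed
  finally show "(\<integral>\<^sup>+x. ennreal (norm (?f x)) \<partial>lborel) < \<infinity>" .
qed

lemma weight_exp_integrable:
  assumes "nonquasianalytic_weight \<omega>"
  obtains \<mu> where "\<mu> > 0" "integrable lborel (\<lambda>x :: real ^ 'n::finite. exp (- \<mu> * \<omega> (norm x)))"
proof -
  from assms obtain a b where ab: "b > 0" "\<And>t. t \<ge> 0 \<Longrightarrow> a + b * ln (1 + t) \<le> \<omega> t"
    unfolding nonquasianalytic_weight_def by blast
  define p where "p = DIM(real ^ 'n) + 2"
  \<comment> \<open>With \<open>\<mu> * b = p\<close>, the logarithmic lower bound in (\<gamma>)
    turns into the integrable power of \<open>1 + norm x\<close>.\<close>
  define \<mu> where "\<mu> = real p / b"
  have \<mu>: "\<mu> > 0"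
    using ab by (simp add: \<mu>_def p_def)
  have "integrable lborel (\<lambda>x :: real ^ 'n. exp (- \<mu> * \<omega> (norm x)))"
  proof (rule Bochner_Integration.integrable_bound)
    show "integrable lborel (\<lambda>x :: real ^ 'n. exp (- \<mu> * a) * inverse ((1 + norm x) ^ p))"
      unfolding p_def by (intro integrable_mult_right integrable_inverse_power_norm)
    show "(\<lambda>x :: real ^ 'n. exp (- \<mu> * \<omega> (norm x))) \<in> borel_measurable lborel"
      by (simp, intro borel_measurable_continuous_onI continuous_intros weight_continuous[OF assms])
    show "AE x :: real ^ 'n in lborel. norm (exp (- \<mu> * \<omega> (norm x)))
        \<le> norm (exp (- \<mu> * a) * inverse ((1 + norm x) ^ p))"
    proof (rule AE_I2)
      fix x :: "real ^ 'n"
      have "- \<mu> * \<omega> (norm x) \<le> - \<mu> * (a + b * ln (1 + norm x))"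
        using \<mu> ab(2)[of "norm x"] by simp
      also have "\<dots> = - \<mu> * a - real p * ln (1 + norm x)"
        using ab(1) by (simp add: \<mu>_def field_simps)
      finally have "exp (- \<mu> * \<omega> (norm x)) \<le> exp (- \<mu> * a - real p * ln (1 + norm x))"
        by simp
      also have "\<dots> = exp (- \<mu> * a) * inverse ((1 + norm x) ^ p)"
        unfolding exp_diff exp_of_nat_mult
        by (subst exp_ln) (auto simp: divide_inverse add_pos_nonneg)
      finally show "norm (exp (- \<mu> * \<omega> (norm x))) \<le> norm (exp (- \<mu> * a) * inverse ((1 + norm x) ^ p))"
        by simp
    qed
  qed
  with \<mu> that show ?thesis
    by blast
qed

text \<open>Splitting \<open>exp (l * \<omega> x)\<close> by the quasi-subadditivity of \<open>\<omega>\<close> costs part of the decay of both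
  factors; what remains of the decay of \<open>f\<close> makes the convolution integral converge.\<close>

lemma weighted_convolution_bound:
  assumes w: "nonquasianalytic_weight \<omega>" and l: "l > 0"
  obtains N C where "N \<ge> 1" "C > 0"
    "\<And>(f :: real ^ 'n::finite \<Rightarrow> complex) g A B x.
      (\<And>x. exp (real N * \<omega> (norm x)) * norm (f x) \<le> A) \<Longrightarrow>
      (\<And>x. exp (real N * \<omega> (norm x)) * norm (g x) \<le> B) \<Longrightarrow>
      exp (l * \<omega> (norm x)) * norm ((f \<star> g) x) \<le> C * A * B"
proof -
  obtain K where K: "K \<ge> 1"
    "\<And>x y :: real ^ 'n. \<omega> (norm x) \<le> K * (1 + \<omega> (norm y) + \<omega> (norm (x - y)))"
    using weight_quasi_subadditive[OF w] by blast
  obtain \<mu> where \<mu>: "\<mu> > 0" "integrable lborel (\<lambda>x :: real ^ 'n. exp (- \<mu> * \<omega> (norm x)))"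
    using weight_exp_integrable[OF w] by blast
  \<comment> \<open>Splitting the weight costs \<open>l * K\<close> on each factor; the additional
    \<open>\<mu>\<close> on \<open>f\<close> is kept for integrability in \<open>y\<close>.\<close>
  define N where "N = nat \<lceil>l * K + \<mu>\<rceil>"
  define I where "I = (LINT x :: real ^ 'n|lborel. exp (- \<mu> * \<omega> (norm x)))"
  have I: "I \<ge> 0"
    unfolding I_def by (rule integral_nonneg_AE) simp
  have lK: "l * K > 0"
    using l K(1) by simp
  have N: "real N \<ge> l * K + \<mu>" "N \<ge> 1"
    using lK \<mu>(1) unfolding N_def by linarith+
  \<comment> \<open>\<open>I + 1\<close> in place of \<open>I\<close> makes the constant strictly
    positive.\<close>
  have "exp (l * \<omega> (norm x)) * norm ((f \<star> g) x) \<le> exp (l * K) * (I + 1) * A * B"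
    if A: "\<And>x. exp (real N * \<omega> (norm x)) * norm (f x) \<le> A"
      and B: "\<And>x. exp (real N * \<omega> (norm x)) * norm (g x) \<le> B"
    for f g :: "real ^ 'n \<Rightarrow> complex" and A B x
  proof -
    have "0 \<le> exp (real N * \<omega> (norm x)) * norm (f x)" "0 \<le> exp (real N * \<omega> (norm x)) * norm (g x)"
      by auto
    with A[of x] B[of x] have AB: "0 \<le> A" "0 \<le> B"
      by linarith+
    have bound: "exp (l * \<omega> (norm x)) * norm (f y * g (x - y))
        \<le> exp (l * K) * A * B * exp (- \<mu> * \<omega> (norm y))" for y
    proof -
      let ?u = "\<omega> (norm y)" and ?v = "\<omega> (norm (x - y))"
      have uv: "0 \<le> ?u" "0 \<le> ?v"
        by (rule weight_nonneg[OF w])+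
      have "l * \<omega> (norm x) \<le> l * (K * (1 + ?u + ?v))"
        using l K(2)[of x y] by simp
      also have "\<dots> = l * K + (l * K) * ?u + (l * K) * ?v"
        by (simp add: algebra_simps)
      also have "\<dots> \<le> l * K + (real N - \<mu>) * ?u + real N * ?v"
        using N(1) \<mu>(1) uv l K(1) by (intro add_mono mult_right_mono) auto
      finally have "exp (l * \<omega> (norm x)) \<le> exp (l * K + (real N - \<mu>) * ?u + real N * ?v)"
        by simp
      also have "\<dots> = exp (l * K) * exp (- \<mu> * ?u) * exp (real N * ?u) * exp (real N * ?v)"
        by (simp add: exp_add[symmetric] algebra_simps)
      finally have "exp (l * \<omega> (norm x)) * norm (f y * g (x - y)) \<le>
          exp (l * K) * exp (- \<mu> * ?u) * exp (real N * ?u) * exp (real N * ?v) *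
          norm (f y * g (x - y))"
        by (rule mult_right_mono) simp
      also have "\<dots> = (exp (l * K) * exp (- \<mu> * ?u)) *
          ((exp (real N * ?u) * norm (f y)) * (exp (real N * ?v) * norm (g (x - y))))"
        by (simp add: norm_mult)
      also have "\<dots> \<le> (exp (l * K) * exp (- \<mu> * ?u)) * (A * B)"
        using A[of y] B[of "x - y"] AB by (intro mult_left_mono mult_mono) auto
      finally show ?thesis
        by (simp add: mult_ac)
    qed
    have "exp (l * \<omega> (norm x)) * norm ((f \<star> g) x) =
        norm (LINT y|lborel. exp (l * \<omega> (norm x)) *\<^sub>R (f y * g (x - y)))"
      unfolding convolution_def by simp
    also have "\<dots> \<le> (LINT y|lborel. norm (exp (l * \<omega> (norm x)) *\<^sub>R (f y * g (x - y))))"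
      by (rule integral_norm_bound)
    also have "\<dots> \<le> (LINT y :: real ^ 'n|lborel. exp (l * K) * A * B * exp (- \<mu> * \<omega> (norm y)))"
    proof (rule Bochner_Integration.integral_mono')
      show "integrable lborel (\<lambda>y :: real ^ 'n. exp (l * K) * A * B * exp (- \<mu> * \<omega> (norm y)))"
        by (intro integrable_mult_right \<mu>(2))
    qed (use bound AB in auto)
    also have "\<dots> = exp (l * K) * A * B * I"
      unfolding I_def by simp
    also have "\<dots> \<le> exp (l * K) * (I + 1) * A * B"
      using AB I by (simp add: algebra_simps)
    finally show ?thesis .
  qed
  then show ?thesis
    using that[of N "exp (l * K) * (I + 1)"] N(2) I by simp
qed

subsection \<open>Rapidly decreasing functions\<close>

lemma wnorm_upper: "ennreal (exp (l * \<omega> (norm x)) * norm (F x)) \<le> wnorm \<omega> l F"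
  unfolding wnorm_def by (rule SUP_upper2[of x]) auto

lemma wnorm_least:
  "(\<And>x. ennreal (exp (l * \<omega> (norm x)) * norm (F x)) \<le> C) \<Longrightarrow> wnorm \<omega> l F \<le> C"
  unfolding wnorm_def by (rule SUP_least) simp

lemma wnorm_finiteD:
  assumes "wnorm \<omega> l F < \<infinity>"
  shows "exp (l * \<omega> (norm x)) * norm (F x) \<le> enn2real (wnorm \<omega> l F)"
proof -
  have "ennreal (exp (l * \<omega> (norm x)) * norm (F x)) \<le> ennreal (enn2real (wnorm \<omega> l F))"
    using wnorm_upper[of l \<omega> x F] assms by simp
  then show ?thesis
    by (subst (asm) ennreal_le_iff) auto
qed

lemma wnorm_add: "wnorm \<omega> l (\<lambda>x. F x + G x) \<le> wnorm \<omega> l F + wnorm \<omega> l G"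
proof (rule wnorm_least)
  fix x
  have "exp (l * \<omega> (norm x)) * norm (F x + G x) \<le>
      exp (l * \<omega> (norm x)) * norm (F x) + exp (l * \<omega> (norm x)) * norm (G x)"
    by (simp add: norm_triangle_ineq flip: distrib_left)
  then have "ennreal (exp (l * \<omega> (norm x)) * norm (F x + G x)) \<le>
      ennreal (exp (l * \<omega> (norm x)) * norm (F x)) + ennreal (exp (l * \<omega> (norm x)) * norm (G x))"
    by (simp flip: ennreal_plus)
  also have "\<dots> \<le> wnorm \<omega> l F + wnorm \<omega> l G"
    by (intro add_mono wnorm_upper)
  finally show "ennreal (exp (l * \<omega> (norm x)) * norm (F x + G x)) \<le> wnorm \<omega> l F + wnorm \<omega> l G" .
qed

lemma wnorm_cmult: "wnorm \<omega> l (\<lambda>x. c * F x) \<le> ennreal (norm c) * wnorm \<omega> l F"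
proof (rule wnorm_least)
  fix x
  have "ennreal (exp (l * \<omega> (norm x)) * norm (c * F x)) =
      ennreal (norm c) * ennreal (exp (l * \<omega> (norm x)) * norm (F x))"
    by (simp add: norm_mult mult_ac flip: ennreal_mult)
  also have "\<dots> \<le> ennreal (norm c) * wnorm \<omega> l F"
    by (intro mult_left_mono wnorm_upper) simp
  finally show "ennreal (exp (l * \<omega> (norm x)) * norm (c * F x)) \<le> ennreal (norm c) * wnorm \<omega> l F" .
qed

text \<open>The exponential weight is at least 1, so one copy of it may be replaced by two, one for
  each factor.\<close>

lemma wnorm_mult:
  assumes "nonquasianalytic_weight \<omega>" "l > 0"
  shows "wnorm \<omega> l (\<lambda>x. F x * G x) \<le> wnorm \<omega> l F * wnorm \<omega> l G"
proof (rule wnorm_least)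
  fix x :: "real ^ 'a"
  let ?e = "exp (l * \<omega> (norm x))"
  have "1 \<le> ?e"
    using weight_nonneg[OF assms(1), of x] assms(2) by simp
  then have "?e * norm (F x * G x) * 1 \<le> ?e * norm (F x * G x) * ?e"
    by (intro mult_left_mono) auto
  then have "ennreal (?e * norm (F x * G x)) \<le> ennreal ((?e * norm (F x)) * (?e * norm (G x)))"
    by (intro ennreal_leI) (simp add: norm_mult mult_ac)
  also have "\<dots> = ennreal (?e * norm (F x)) * ennreal (?e * norm (G x))"
    by (simp add: ennreal_mult)
  also have "\<dots> \<le> wnorm \<omega> l F * wnorm \<omega> l G"
    by (intro mult_mono wnorm_upper) auto
  finally show "ennreal (?e * norm (F x * G x)) \<le> wnorm \<omega> l F * wnorm \<omega> l G" .
qed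

text \<open>The pointwise estimate with \<open>A\<close> and \<open>B\<close> chosen as the norms
  themselves, which finiteness makes available as real bounds.\<close>

lemma wnorm_convolution:
  assumes w: "nonquasianalytic_weight \<omega>" and l: "l > 0"
  obtains N C where "N \<ge> 1" "C > 0"
    "\<And>f g :: real ^ 'n::finite \<Rightarrow> complex.
      wnorm \<omega> (real N) f < \<infinity> \<Longrightarrow> wnorm \<omega> (real N) g < \<infinity> \<Longrightarrow>
      wnorm \<omega> l (f \<star> g) \<le> ennreal C * wnorm \<omega> (real N) f * wnorm \<omega> (real N) g"
proof -
  obtain N C where N: "N \<ge> 1" "C > 0"
    "\<And>(f :: real ^ 'n \<Rightarrow> complex) g A B x.
      (\<And>x. exp (real N * \<omega> (norm x)) * norm (f x) \<le> A) \<Longrightarrow>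
      (\<And>x. exp (real N * \<omega> (norm x)) * norm (g x) \<le> B) \<Longrightarrow>
      exp (l * \<omega> (norm x)) * norm ((f \<star> g) x) \<le> C * A * B"
    using weighted_convolution_bound[OF w l] by blast
  show ?thesis
  proof (rule that[OF N(1,2)])
    fix f g :: "real ^ 'n \<Rightarrow> complex"
    assume fin: "wnorm \<omega> (real N) f < \<infinity>" "wnorm \<omega> (real N) g < \<infinity>"
    let ?A = "enn2real (wnorm \<omega> (real N) f)" and ?B = "enn2real (wnorm \<omega> (real N) g)"
    have "wnorm \<omega> l (f \<star> g) \<le> ennreal (C * ?A * ?B)"
      by (intro wnorm_least ennreal_leI N(3) wnorm_finiteD fin)
    also have "\<dots> = ennreal C * wnorm \<omega> (real N) f * wnorm \<omega> (real N) g"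
      using N(2) fin by (simp add: ennreal_mult)
    finally show "wnorm \<omega> l (f \<star> g) \<le> ennreal C * wnorm \<omega> (real N) f * wnorm \<omega> (real N) g" .
  qed
qed

text \<open>The condition that \<open>S_space\<close> imposes on \<open>f\<close> and on its Fourier
  transform alike. Derivatives are indexed by lists, which makes closure under a further partial
  derivative a matter of appending lists.\<close>

definition rapid :: "(real \<Rightarrow> real) \<Rightarrow> (real ^ 'n::finite \<Rightarrow> complex) \<Rightarrow> bool" where
  "rapid \<omega> f \<longleftrightarrow> smooth f \<and> (\<forall>is. \<forall>l>0. wnorm \<omega> l (foldr partial is f) < \<infinity>)"

lemma rapid_smooth: "rapid \<omega> f \<Longrightarrow> smooth f"
  by (simp add: rapid_def)

lemma rapid_foldr: "rapid \<omega> f \<Longrightarrow> rapid \<omega> (foldr partial js f)"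
  unfolding rapid_def by (auto simp: smooth_foldr foldr_append[symmetric] simp del: foldr_append)

lemma rapid_partial: "rapid \<omega> f \<Longrightarrow> rapid \<omega> (partial i f)"
  using rapid_foldr[of \<omega> f "[i]"] by simp

lemma rapid_wnorm: "rapid \<omega> f \<Longrightarrow> l > 0 \<Longrightarrow> wnorm \<omega> l f < \<infinity>"
  unfolding rapid_def by (auto dest: spec[of _ "[]"])

lemma rapid_measurable: "rapid \<omega> f \<Longrightarrow> f \<in> borel_measurable borel"
  by (intro borel_measurable_continuous_onI smooth_continuous rapid_smooth)

lemma S_space_iff:
  "f \<in> S_space \<omega> \<longleftrightarrow> integrable lborel f \<and> rapid \<omega> f \<and> rapid \<omega> (fourier f)"
proof -
  have "(\<forall>is. \<forall>l>0. wnorm \<omega> l (foldr partial is g) < \<infinity>) \<longleftrightarrow>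
      (\<forall>l>0. \<forall>\<alpha>. wnorm \<omega> l (mderiv \<alpha> g) < \<infinity>)"
    if "smooth g" for g :: "real ^ 'a \<Rightarrow> complex"
    by (auto simp: mderiv_eq_foldr)
      (subst foldr_partial_eq_mderiv[OF that], simp add: mderiv_eq_foldr)
  then have "rapid \<omega> g \<longleftrightarrow> smooth g \<and> (\<forall>l>0. \<forall>\<alpha>. wnorm \<omega> l (mderiv \<alpha> g) < \<infinity>)"
    for g :: "real ^ 'a \<Rightarrow> complex"
    unfolding rapid_def by blast
  then show ?thesis
    unfolding S_space_def by auto
qed

lemma rapid_bounded:
  assumes "nonquasianalytic_weight \<omega>" "rapid \<omega> f"
  obtains B where "\<And>x. norm (f x) \<le> B"
proof -
  have "norm (f x) \<le> enn2real (wnorm \<omega> 1 f)" for x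
  proof -
    have "1 * norm (f x) \<le> exp (1 * \<omega> (norm x)) * norm (f x)"
      using weight_nonneg[OF assms(1), of x] by (intro mult_right_mono) auto
    also have "\<dots> \<le> enn2real (wnorm \<omega> 1 f)"
      by (intro wnorm_finiteD rapid_wnorm[OF assms(2)]) simp
    finally show ?thesis
      by simp
  qed
  with that show ?thesis
    by blast
qed

text \<open>Finiteness of the weighted norm at the exponent \<mu> dominates \<open>f\<close> by a
  multiple of the integrable function \<open>exp (- \<mu> * \<omega> (norm x))\<close>.\<close>

lemma rapid_integrable:
  assumes w: "nonquasianalytic_weight \<omega>" and f: "rapid \<omega> f"
  shows "integrable lborel f"
proof -
  obtain \<mu> where \<mu>: "\<mu> > 0" "integrable lborel (\<lambda>x :: real ^ 'a. exp (- \<mu> * \<omega> (norm x)))"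
    using weight_exp_integrable[OF w] by blast
  let ?C = "enn2real (wnorm \<omega> \<mu> f)"
  show ?thesis
  proof (rule Bochner_Integration.integrable_bound)
    show "integrable lborel (\<lambda>x :: real ^ 'a. ?C * exp (- \<mu> * \<omega> (norm x)))"
      using \<mu>(2) by simp
    show "f \<in> borel_measurable lborel"
      using rapid_measurable[OF f] by simp
    have "norm (f x) \<le> ?C * exp (- \<mu> * \<omega> (norm x))" for x
    proof -
      have "norm (f x) = exp (- \<mu> * \<omega> (norm x)) * (exp (\<mu> * \<omega> (norm x)) * norm (f x))"
        by (simp flip: mult.assoc exp_add)
      also have "\<dots> \<le> exp (- \<mu> * \<omega> (norm x)) * ?C"
        by (intro mult_left_mono wnorm_finiteD rapid_wnorm[OF f \<mu>(1)]) simp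
      finally show ?thesis
        by (simp only: mult.commute)
    qed
    then show "AE x in lborel. norm (f x) \<le> norm (?C * exp (- \<mu> * \<omega> (norm x)))"
      by (simp add: abs_mult)
  qed
qed

text \<open>All derivatives fall on \<open>g\<close>. The weighted bound for the convolution then
  applies to \<open>f\<close> and the derivative of \<open>g\<close>, which is again rapidly
  decreasing.\<close>

lemma
  assumes w: "nonquasianalytic_weight \<omega>" and f: "rapid \<omega> f" and g: "rapid \<omega> g"
  shows foldr_partial_rapid_convolution: "foldr partial is (f \<star> g) = f \<star> foldr partial is g"
    and rapid_convolution: "rapid \<omega> (f \<star> g)"
proof -
  have bdd: "\<exists>B. \<forall>x. norm (foldr partial is g x) \<le> B" for "is"
    by (rule rapid_bounded[OF w rapid_foldr[OF g, of "is"]]) blast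
  show eq: "foldr partial is (f \<star> g) = f \<star> foldr partial is g" for "is"
    by (rule foldr_partial_convolution[OF rapid_integrable[OF w f] rapid_smooth[OF g] bdd])
  show "rapid \<omega> (f \<star> g)"
    unfolding rapid_def eq
  proof safe
    show "smooth (f \<star> g)"
      by (rule smooth_convolution[OF rapid_integrable[OF w f] rapid_smooth[OF g] bdd])
    fix "is" and l :: real assume l: "l > 0"
    obtain N C where N: "N \<ge> 1" "C > 0"
      "\<And>f g :: real ^ 'a \<Rightarrow> complex.
        wnorm \<omega> (real N) f < \<infinity> \<Longrightarrow> wnorm \<omega> (real N) g < \<infinity> \<Longrightarrow>
        wnorm \<omega> l (f \<star> g) \<le> ennreal C * wnorm \<omega> (real N) f * wnorm \<omega> (real N) g"
      by (rule wnorm_convolution[OF w l]) (rule that)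
    have fin: "wnorm \<omega> (real N) f < \<infinity>" "wnorm \<omega> (real N) (foldr partial is g) < \<infinity>"
      using N(1) by (intro rapid_wnorm rapid_foldr f g; simp)+
    show "wnorm \<omega> l (f \<star> foldr partial is g) < \<infinity>"
      using fin by (intro le_less_trans[OF N(3)[OF fin]]) (simp add: ennreal_mult_less_top)
  qed
qed

text \<open>The partial derivatives of a product of rapidly decreasing functions are sums of such products,
  so it suffices to control the sums themselves.\<close>

inductive product_sum :: "(real \<Rightarrow> real) \<Rightarrow> (real ^ 'n::finite \<Rightarrow> complex) \<Rightarrow> bool" for \<omega> where
  product: "rapid \<omega> f \<Longrightarrow> rapid \<omega> g \<Longrightarrow> product_sum \<omega> (\<lambda>x. f x * g x)"
| plus: "product_sum \<omega> p \<Longrightarrow> product_sum \<omega> q \<Longrightarrow> product_sum \<omega> (\<lambda>x. p x + q x)"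

lemma product_sum_continuous: "product_sum \<omega> h \<Longrightarrow> continuous_on UNIV h"
proof (induction rule: product_sum.induct)
  case (product f g)
  then show ?case
    by (intro continuous_on_mult smooth_continuous) (rule rapid_smooth, assumption)+
qed (rule continuous_on_add)

text \<open>The Leibniz rule for one product, and additivity for sums. An existential suffices,
  since only membership of the derivative in the class matters.\<close>

lemma product_sum_line_derivative:
  "product_sum \<omega> h \<Longrightarrow> \<exists>h'. product_sum \<omega> h' \<and>
    (\<forall>x. ((\<lambda>t. h (x + t *\<^sub>R axis i 1)) has_vector_derivative h' x) (at 0))"
proof (induction rule: product_sum.induct)
  case (product f g)
  have "((\<lambda>t. f (x + t *\<^sub>R axis i 1) * g (x + t *\<^sub>R axis i 1)) has_vector_derivative
      f x * partial i g x + partial i f x * g x) (at 0)" for x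
    using has_vector_derivative_mult[OF
        smooth_line_derivative[OF rapid_smooth[OF product(1)], of x i 0]
        smooth_line_derivative[OF rapid_smooth[OF product(2)], of x i 0]] by simp
  moreover have "product_sum \<omega> (\<lambda>x. f x * partial i g x + partial i f x * g x)"
    by (intro product_sum.intros rapid_partial product)
  ultimately show ?case
    by blast
next
  case (plus p q)
  then obtain p' q' where "product_sum \<omega> p'" "product_sum \<omega> q'"
    "\<And>x. ((\<lambda>t. p (x + t *\<^sub>R axis i 1)) has_vector_derivative p' x) (at 0)"
    "\<And>x. ((\<lambda>t. q (x + t *\<^sub>R axis i 1)) has_vector_derivative q' x) (at 0)"
    by blast
  then show ?case
    by (intro exI[of _ "\<lambda>x. p' x + q' x"] conjI allI product_sum.plus has_vector_derivative_add)
qed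

lemma product_sum_wnorm:
  assumes "nonquasianalytic_weight \<omega>" "l > 0"
  shows "product_sum \<omega> h \<Longrightarrow> wnorm \<omega> l h < \<infinity>"
proof (induction rule: product_sum.induct)
  case (product f g)
  show ?case
    using rapid_wnorm[OF product(1) assms(2)] rapid_wnorm[OF product(2) assms(2)]
    by (intro le_less_trans[OF wnorm_mult[OF assms]]) (simp add: ennreal_mult_less_top)
next
  case (plus p q)
  then show ?case
    by (intro le_less_trans[OF wnorm_add]) simp
qed

text \<open>Uniqueness of derivatives shows that sums of products are closed under
  \<open>partial i\<close>. Hence every iterated derivative of \<open>f * g\<close> is such a sum,
  and so is continuous, differentiable along lines and of finite weighted norm.\<close>

lemma rapid_mult:
  assumes w: "nonquasianalytic_weight \<omega>" and "rapid \<omega> f" "rapid \<omega> g"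
  shows "rapid \<omega> (\<lambda>x. f x * g x)"
proof -
  have "product_sum \<omega> (partial i h)" if "product_sum \<omega> h" for i and h :: "real ^ 'a \<Rightarrow> complex"
  proof -
    obtain h' where h': "product_sum \<omega> h'"
      "\<And>x. ((\<lambda>t. h (x + t *\<^sub>R axis i 1)) has_vector_derivative h' x) (at 0)"
      using product_sum_line_derivative[OF \<open>product_sum \<omega> h\<close>] by blast
    then have "partial i h = h'"
      by (intro ext partial_eqI)
    with h'(1) show ?thesis
      by simp
  qed
  then have ps: "product_sum \<omega> (foldr partial is (\<lambda>x. f x * g x))" for "is"
    by (induction "is") (auto intro: product_sum.product assms)
  show ?thesis
    unfolding rapid_def smooth_def
  proof safe
    fix "is" i x and l :: real
    show "continuous_on UNIV (foldr partial is (\<lambda>x. f x * g x))"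
      by (rule product_sum_continuous[OF ps])
    show "(\<lambda>t. foldr partial is (\<lambda>x. f x * g x) (x + t *\<^sub>R axis i 1)) differentiable at 0"
      using product_sum_line_derivative[OF ps, where i = i] differentiableI_vector by blast
    assume "l > 0"
    then show "wnorm \<omega> l (foldr partial is (\<lambda>x. f x * g x)) < \<infinity>"
      by (rule product_sum_wnorm[OF w _ ps])
  qed
qed

lemma S_space_convolution:
  assumes w: "nonquasianalytic_weight \<omega>" and f: "f \<in> S_space \<omega>" and g: "g \<in> S_space \<omega>"
  shows "f \<star> g \<in> S_space \<omega>"
proof -
  have r: "rapid \<omega> f" "rapid \<omega> g" "rapid \<omega> (fourier f)" "rapid \<omega> (fourier g)"
    using f g by (auto simp: S_space_iff)
  have "rapid \<omega> (f \<star> g)"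
    by (rule rapid_convolution[OF w r(1,2)])
  moreover have "rapid \<omega> (fourier (f \<star> g))"
    by (simp add: fourier_convolution rapid_integrable[OF w] r rapid_mult[OF w])
  ultimately show ?thesis
    by (simp add: S_space_iff rapid_integrable[OF w])
qed

section \<open>Linearity of derivatives and bilinearity of convolution\<close>

lemma smooth_linear_line_derivative:
  assumes "smooth f" "smooth g"
  shows "((\<lambda>t. a * f (x + t *\<^sub>R axis i 1) + b * g (x + t *\<^sub>R axis i 1)) has_vector_derivative
    a * partial i f x + b * partial i g x) (at 0)"
  using smooth_line_derivative[OF assms(1), of x i 0] smooth_line_derivative[OF assms(2), of x i 0]
  by (auto intro!: has_vector_derivative_add has_vector_derivative_mult_right)

lemma foldr_partial_linear:
  assumes "smooth f" "smooth g"
  shows "foldr partial is (\<lambda>x. a * f x + b * g x) =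
    (\<lambda>x. a * foldr partial is f x + b * foldr partial is g x)"
proof (induction "is")
  case (Cons i "is")
  have "partial i (\<lambda>x. a * foldr partial is f x + b * foldr partial is g x) =
      (\<lambda>x. a * partial i (foldr partial is f) x + b * partial i (foldr partial is g) x)"
    by (intro ext partial_eqI smooth_linear_line_derivative smooth_foldr assms)
  with Cons show ?case
    by simp
qed simp

lemma rapid_linear:
  assumes "rapid \<omega> f" "rapid \<omega> g"
  shows "rapid \<omega> (\<lambda>x. a * f x + b * g x)"
proof -
  note smooth = assms[THEN rapid_smooth]
  show ?thesis
    unfolding rapid_def smooth_def foldr_partial_linear[OF smooth]
  proof safe
    fix "is" i x and l :: real
    show "continuous_on UNIV (\<lambda>x. a * foldr partial is f x + b * foldr partial is g x)"
      by (intro continuous_intros smooth_continuous smooth_foldr smooth)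
    show "(\<lambda>t. a * foldr partial is f (x + t *\<^sub>R axis i 1) + b * foldr partial is g (x + t *\<^sub>R axis i 1))
        differentiable at 0"
      by (rule differentiableI_vector[OF smooth_linear_line_derivative])
        (intro smooth_foldr smooth)+
    assume l: "l > 0"
    have "wnorm \<omega> l (\<lambda>x. a * foldr partial is f x + b * foldr partial is g x) \<le>
        ennreal (norm a) * wnorm \<omega> l (foldr partial is f) +
        ennreal (norm b) * wnorm \<omega> l (foldr partial is g)"
      by (rule order_trans[OF wnorm_add add_mono]) (rule wnorm_cmult)+
    also have "\<dots> < \<infinity>"
      using rapid_wnorm[OF rapid_foldr[OF assms(1)] l] rapid_wnorm[OF rapid_foldr[OF assms(2)] l]
      by (simp add: ennreal_mult_less_top)
    finally show "wnorm \<omega> l (\<lambda>x. a * foldr partial is f x + b * foldr partial is g x) < \<infinity>" .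
  qed
qed

lemma rapid_diff: "rapid \<omega> f \<Longrightarrow> rapid \<omega> g \<Longrightarrow> rapid \<omega> (\<lambda>x. f x - g x)"
  using rapid_linear[of \<omega> f g 1 "-1"] by simp

text \<open>The integral may be split because each summand is an integrable function times a bounded
  one.\<close>

lemma convolution_linear_right:
  assumes w: "nonquasianalytic_weight \<omega>" and "rapid \<omega> f" "rapid \<omega> g" "rapid \<omega> h"
  shows "h \<star> (\<lambda>x. a * f x + b * g x) = (\<lambda>x. a * (h \<star> f) x + b * (h \<star> g) x)"
proof
  fix x
  have int: "integrable lborel (\<lambda>y. h y * u (x - y))" if u: "rapid \<omega> u" for u
  proof -
    obtain B where B: "\<And>x. norm (u x) \<le> B"
      using rapid_bounded[OF w u] by blast
    show ?thesis
      using assms u by (intro convolution_integrable[OF _ _ B] rapid_integrable rapid_measurable)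
  qed
  have "(h \<star> (\<lambda>x. a * f x + b * g x)) x =
      (LINT y|lborel. a * (h y * f (x - y)) + b * (h y * g (x - y)))"
    unfolding convolution_def by (simp add: algebra_simps)
  also have "\<dots> = a * (h \<star> f) x + b * (h \<star> g) x"
    unfolding convolution_def using int assms by simp
  finally show "(h \<star> (\<lambda>x. a * f x + b * g x)) x = a * (h \<star> f) x + b * (h \<star> g) x" .
qed

lemma rapid_convolution_commute: "rapid \<omega> f \<Longrightarrow> rapid \<omega> g \<Longrightarrow> f \<star> g = g \<star> f"
  by (intro convolution_commute rapid_measurable)

lemma bilinear_convolution:
  assumes w: "nonquasianalytic_weight \<omega>"
  shows "bilinear_on (S_space \<omega> :: (real ^ 'n::finite \<Rightarrow> complex) set) (\<star>)"
  unfolding bilinear_on_def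
proof safe
  fix f g h :: "real ^ 'n \<Rightarrow> complex" and a b
  assume "f \<in> S_space \<omega>" "g \<in> S_space \<omega>" "h \<in> S_space \<omega>"
  then have r: "rapid \<omega> f" "rapid \<omega> g" "rapid \<omega> h"
    by (auto simp: S_space_iff)
  show right: "h \<star> (\<lambda>x. a * f x + b * g x) = (\<lambda>x. a * (h \<star> f) x + b * (h \<star> g) x)"
    by (rule convolution_linear_right[OF w r])
  show "(\<lambda>x. a * f x + b * g x) \<star> h = (\<lambda>x. a * (f \<star> h) x + b * (g \<star> h) x)"
    unfolding rapid_convolution_commute[OF rapid_linear[OF r(1,2)] r(3)]
      rapid_convolution_commute[OF r(1,3)] rapid_convolution_commute[OF r(2,3)]
    by (rule right)
qed

text \<open>The usual telescoping identity. Commutativity puts both differences in the second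
  position, where \<open>qnorm_convolution\<close> measures them by \<open>qnorm\<close>, while
  \<open>g\<close> and \<open>f0\<close> enter only through \<open>wnorm\<close>.\<close>

lemma convolution_diff_split:
  assumes w: "nonquasianalytic_weight \<omega>"
    and r: "rapid \<omega> f" "rapid \<omega> g" "rapid \<omega> f0" "rapid \<omega> g0"
  shows "(\<lambda>x. (f \<star> g) x - (f0 \<star> g0) x) =
    (\<lambda>x. (g \<star> (\<lambda>x. f x - f0 x)) x + (f0 \<star> (\<lambda>x. g x - g0 x)) x)"
  using convolution_linear_right[OF w r(1,3,2), of 1 "-1"]
    convolution_linear_right[OF w r(2,4,3), of 1 "-1"]
    rapid_convolution_commute[OF r(1,2)] rapid_convolution_commute[OF r(3,2)]
  by simp

subsection \<open>Continuity of the convolution\<close>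

text \<open>The normalization gives the value 0 at \<open>t = 0\<close>, and nonnegativity of
  \<omega> excludes larger values.\<close>

lemma young_conjugate_zero:
  assumes "nonquasianalytic_weight \<omega>"
  shows "young_conjugate \<omega> 0 = 0"
proof -
  have nonneg: "0 \<le> \<omega> (exp t)" for t
    using weight_nonneg[OF assms, of "exp t"] by simp
  have "\<omega> 1 = 0"
    using assms unfolding nonquasianalytic_weight_def by simp
  then have "ereal (- \<omega> (exp 0)) = 0"
    by simp
  then show ?thesis
    unfolding young_conjugate_def
    by (intro antisym SUP_least SUP_upper2[of 0]) (auto simp: nonneg zero_ereal_def)
qed

text \<open>The term of the zero multi-index in the supremum carries the factor
  \<open>exp 0 = 1\<close>.\<close>

lemma wnorm_le_qnorm:
  assumes "nonquasianalytic_weight \<omega>"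
  shows "wnorm \<omega> (real n) f \<le> qnorm \<omega> m n f"
proof -
  have "foldr (\<lambda>i. partial i ^^ 0) is f = f" for "is"
    by (induction "is") auto
  then have "mderiv (\<lambda>_. 0) f = f"
    unfolding mderiv_def .
  then show ?thesis
    unfolding qnorm_def
    by (intro SUP_upper2[of "\<lambda>_. 0"])
      (auto simp: young_conjugate_zero[OF assms] exp_ereal_def zero_ereal_def[symmetric])
qed

lemma qnorm_add:
  assumes "smooth f" "smooth g"
  shows "qnorm \<omega> m n (\<lambda>x. f x + g x) \<le> qnorm \<omega> m n f + qnorm \<omega> m n g"
  unfolding qnorm_def
proof (rule SUP_least)
  fix \<alpha> :: "'a \<Rightarrow> nat"
  let ?e = "\<lambda>\<alpha> :: 'a \<Rightarrow> nat.
    exp_ereal (- (ereal (real m) * young_conjugate \<omega> (real (\<Sum>i\<in>UNIV. \<alpha> i) / real m)))"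
  have "mderiv \<alpha> (\<lambda>x. f x + g x) = (\<lambda>x. mderiv \<alpha> f x + mderiv \<alpha> g x)"
    using foldr_partial_linear[OF assms, of "indices \<alpha>" 1 1] by (simp add: mderiv_eq_foldr)
  then have "wnorm \<omega> (real n) (mderiv \<alpha> (\<lambda>x. f x + g x)) * ?e \<alpha> \<le>
      (wnorm \<omega> (real n) (mderiv \<alpha> f) + wnorm \<omega> (real n) (mderiv \<alpha> g)) * ?e \<alpha>"
    by (simp add: wnorm_add mult_right_mono)
  also have "\<dots> = wnorm \<omega> (real n) (mderiv \<alpha> f) * ?e \<alpha> + wnorm \<omega> (real n) (mderiv \<alpha> g) * ?e \<alpha>"
    by (rule distrib_right)
  also have "\<dots> \<le> (SUP \<alpha>. wnorm \<omega> (real n) (mderiv \<alpha> f) * ?e \<alpha>) +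
      (SUP \<alpha>. wnorm \<omega> (real n) (mderiv \<alpha> g) * ?e \<alpha>)"
    by (intro add_mono SUP_upper) auto
  finally show "wnorm \<omega> (real n) (mderiv \<alpha> (\<lambda>x. f x + g x)) * ?e \<alpha> \<le>
      (SUP \<alpha>. wnorm \<omega> (real n) (mderiv \<alpha> f) * ?e \<alpha>) +
      (SUP \<alpha>. wnorm \<omega> (real n) (mderiv \<alpha> g) * ?e \<alpha>)" .
qed

text \<open>The constants \<open>N\<close> and \<open>C\<close> depend on \<open>n\<close> but on
  neither \<open>m\<close> nor the multi-index, so the factor with the Young conjugate passes
  unchanged from the derivative of \<open>f \<star> g\<close> to that of \<open>g\<close>.\<close>

lemma qnorm_convolution:
  assumes w: "nonquasianalytic_weight \<omega>" and n: "n \<ge> 1"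
  obtains N C where "N \<ge> 1" "C > 0"
    "\<And>m (f :: real ^ 'n::finite \<Rightarrow> complex) g. rapid \<omega> f \<Longrightarrow> rapid \<omega> g \<Longrightarrow>
      qnorm \<omega> m n (f \<star> g) \<le> ennreal C * wnorm \<omega> (real N) f * qnorm \<omega> m N g"
proof -
  obtain N C where N: "N \<ge> 1" "C > 0"
    "\<And>f g :: real ^ 'n::finite \<Rightarrow> complex.
      wnorm \<omega> (real N) f < \<infinity> \<Longrightarrow> wnorm \<omega> (real N) g < \<infinity> \<Longrightarrow>
      wnorm \<omega> (real n) (f \<star> g) \<le> ennreal C * wnorm \<omega> (real N) f * wnorm \<omega> (real N) g"
    using wnorm_convolution[OF w, of "real n"] n by auto
  show ?thesis
  proof (rule that[OF N(1,2)])
    fix m and f g :: "real ^ 'n \<Rightarrow> complex"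
    assume r: "rapid \<omega> f" "rapid \<omega> g"
    show "qnorm \<omega> m n (f \<star> g) \<le> ennreal C * wnorm \<omega> (real N) f * qnorm \<omega> m N g"
      unfolding qnorm_def[of _ _ n]
    proof (rule SUP_least)
      fix \<alpha> :: "'n \<Rightarrow> nat"
      let ?e = "exp_ereal (- (ereal (real m) * young_conjugate \<omega> (real (\<Sum>i\<in>UNIV. \<alpha> i) / real m)))"
      have "mderiv \<alpha> (f \<star> g) = f \<star> mderiv \<alpha> g"
        unfolding mderiv_eq_foldr by (rule foldr_partial_rapid_convolution[OF w r])
      moreover have "wnorm \<omega> (real n) (f \<star> mderiv \<alpha> g) \<le>
          ennreal C * wnorm \<omega> (real N) f * wnorm \<omega> (real N) (mderiv \<alpha> g)"
        unfolding mderiv_eq_foldr using N(1)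
        by (intro N(3) rapid_wnorm rapid_foldr r) auto
      ultimately have "wnorm \<omega> (real n) (mderiv \<alpha> (f \<star> g)) * ?e \<le>
          ennreal C * wnorm \<omega> (real N) f * (wnorm \<omega> (real N) (mderiv \<alpha> g) * ?e)"
        by (simp add: mult_right_mono flip: mult.assoc)
      also have "\<dots> \<le> ennreal C * wnorm \<omega> (real N) f * qnorm \<omega> m N g"
        unfolding qnorm_def by (intro mult_left_mono SUP_upper) auto
      finally show "wnorm \<omega> (real n) (mderiv \<alpha> (f \<star> g)) * ?e \<le>
          ennreal C * wnorm \<omega> (real N) f * qnorm \<omega> m N g" .
    qed
  qed
qed

section \<open>Balls of the norms and continuity at a point\<close>

lemma openin_S_topology_ball:
  assumes "f \<in> S_space \<omega>" "m \<ge> 1" "n \<ge> 1" "\<epsilon> > 0"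
  shows "openin (S_topology \<omega>) {g \<in> S_space \<omega>. qnorm \<omega> m n (\<lambda>x. g x - f x) < ennreal \<epsilon>}"
  unfolding S_topology_def by (rule topology_generated_by_Basis) (use assms in blast)

lemma qnorm_self: "qnorm \<omega> m n (\<lambda>x. f x - f x) = 0"
  unfolding qnorm_def mderiv_def by (simp add: foldr_partial_zero wnorm_def)

text \<open>Subbasic balls have arbitrary centres \<open>h\<close>, so what must be preserved is the
  strict inequality at \<open>(f0, g0)\<close>; its slack is the room for the perturbation.\<close>

lemma qnorm_convolution_continuous_at:
  fixes f0 g0 h :: "real ^ 'n::finite \<Rightarrow> complex"
  assumes w: "nonquasianalytic_weight \<omega>" and n: "n \<ge> 1"
    and f0: "rapid \<omega> f0" and g0: "rapid \<omega> g0" and h: "rapid \<omega> h"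
    and less: "qnorm \<omega> m n (\<lambda>x. (f0 \<star> g0) x - h x) < ennreal \<epsilon>"
  obtains N \<delta> where "N \<ge> 1" "\<delta> > 0"
    "\<And>f g. rapid \<omega> f \<Longrightarrow> rapid \<omega> g \<Longrightarrow> qnorm \<omega> m N (\<lambda>x. f x - f0 x) < ennreal \<delta> \<Longrightarrow>
      qnorm \<omega> m N (\<lambda>x. g x - g0 x) < ennreal \<delta> \<Longrightarrow>
      qnorm \<omega> m n (\<lambda>x. (f \<star> g) x - h x) < ennreal \<epsilon>"
proof -
  obtain N C where N: "N \<ge> 1" "C > 0"
    "\<And>m (f :: real ^ 'n \<Rightarrow> complex) g. rapid \<omega> f \<Longrightarrow> rapid \<omega> g \<Longrightarrow>
      qnorm \<omega> m n (f \<star> g) \<le> ennreal C * wnorm \<omega> (real N) f * qnorm \<omega> m N g"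
    using qnorm_convolution[OF w n] by blast
  have "wnorm \<omega> (real N) f0 < \<infinity>" "wnorm \<omega> (real N) g0 < \<infinity>"
    using N(1) by (intro rapid_wnorm[OF f0] rapid_wnorm[OF g0]; simp)+
  then obtain A B where A: "A \<ge> 0" "wnorm \<omega> (real N) f0 = ennreal A"
    and B: "B \<ge> 0" "wnorm \<omega> (real N) g0 = ennreal B"
    by (metis ennreal_cases infinity_ennreal_def less_irrefl)
  \<comment> \<open>The norm is finite because it lies below the real number \<epsilon>.\<close>
  obtain a where a: "a \<ge> 0" "qnorm \<omega> m n (\<lambda>x. (f0 \<star> g0) x - h x) = ennreal a"
    using less by (cases "qnorm \<omega> m n (\<lambda>x. (f0 \<star> g0) x - h x)") auto
  with less have "a < \<epsilon>"
    by (simp add: ennreal_less_iff)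
  \<comment> \<open>\<open>C * (1 + B)\<close> comes from the term with \<open>f - f0\<close>, and
    \<open>C * A\<close> from the term with \<open>g - g0\<close>.\<close>
  define D where "D = C * (1 + A + B)"
  \<comment> \<open>The cap 1 bounds the weighted norm of \<open>g\<close> by \<open>1 + B\<close>;
    the other entry makes the perturbation use at most half of the slack
    \<open>\<epsilon> - a\<close>.\<close>
  define \<delta> where "\<delta> = min 1 ((\<epsilon> - a) / (2 * D))"
  have D: "D > 0"
    unfolding D_def using N(2) A(1) B(1) by simp
  have \<delta>: "\<delta> > 0" "\<delta> \<le> 1"
    unfolding \<delta>_def using D \<open>a < \<epsilon>\<close> by auto
  have "D * \<delta> \<le> D * ((\<epsilon> - a) / (2 * D))"
    unfolding \<delta>_def using D by (intro mult_left_mono) auto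
  also have "\<dots> = (\<epsilon> - a) / 2"
    using D by simp
  finally have small: "D * \<delta> + a < \<epsilon>"
    using \<open>a < \<epsilon>\<close> by simp
  show ?thesis
  proof (rule that[OF N(1) \<delta>(1)])
    fix f g
    assume r: "rapid \<omega> f" "rapid \<omega> g"
      and qf: "qnorm \<omega> m N (\<lambda>x. f x - f0 x) < ennreal \<delta>"
      and qg: "qnorm \<omega> m N (\<lambda>x. g x - g0 x) < ennreal \<delta>"
    note df = rapid_diff[OF r(1) f0] and dg = rapid_diff[OF r(2) g0]
    have "wnorm \<omega> (real N) g \<le> wnorm \<omega> (real N) (\<lambda>x. g x - g0 x) + wnorm \<omega> (real N) g0"
      using wnorm_add[of \<omega> "real N" "\<lambda>x. g x - g0 x" g0] by simp
    also have "\<dots> \<le> ennreal 1 + ennreal B"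
    proof (rule add_mono)
      have "wnorm \<omega> (real N) (\<lambda>x. g x - g0 x) \<le> ennreal \<delta>"
        using wnorm_le_qnorm[OF w] qg by (meson le_less_trans less_imp_le)
      also have "\<dots> \<le> ennreal 1"
        using \<delta>(2) by (rule ennreal_leI)
      finally show "wnorm \<omega> (real N) (\<lambda>x. g x - g0 x) \<le> ennreal 1" .
    qed (simp add: B)
    finally have wg: "wnorm \<omega> (real N) g \<le> ennreal (1 + B)"
      using B(1) by simp
    have "qnorm \<omega> m n (\<lambda>x. (f \<star> g) x - h x) =
        qnorm \<omega> m n (\<lambda>x. ((f \<star> g) x - (f0 \<star> g0) x) + ((f0 \<star> g0) x - h x))"
      by simp
    also have "\<dots> \<le> qnorm \<omega> m n (\<lambda>x. (f \<star> g) x - (f0 \<star> g0) x) + ennreal a"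
      unfolding a(2)[symmetric]
      by (intro qnorm_add rapid_smooth[of \<omega>] rapid_diff rapid_convolution w r f0 g0 h)
    also have "\<dots> \<le> (qnorm \<omega> m n (g \<star> (\<lambda>x. f x - f0 x)) + qnorm \<omega> m n (f0 \<star> (\<lambda>x. g x - g0 x)))
        + ennreal a"
      unfolding convolution_diff_split[OF w r f0 g0]
      by (intro add_right_mono qnorm_add rapid_smooth[of \<omega>] rapid_convolution w r df dg f0)
    also have "\<dots> \<le> (ennreal C * ennreal (1 + B) * ennreal \<delta> + ennreal C * ennreal A * ennreal \<delta>)
        + ennreal a"
    proof (intro add_right_mono add_mono)
      show "qnorm \<omega> m n (g \<star> (\<lambda>x. f x - f0 x)) \<le> ennreal C * ennreal (1 + B) * ennreal \<delta>"
        using wg qf by (intro order_trans[OF N(3)[OF r(2) df]] mult_mono) auto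
      show "qnorm \<omega> m n (f0 \<star> (\<lambda>x. g x - g0 x)) \<le> ennreal C * ennreal A * ennreal \<delta>"
        using A qg by (intro order_trans[OF N(3)[OF f0 dg]] mult_mono) auto
    qed
    also have "\<dots> = ennreal (D * \<delta> + a)"
      unfolding D_def using N(2) A(1) B(1) \<delta>(1) a(1)
      by (simp add: algebra_simps flip: ennreal_mult ennreal_plus)
    also have "\<dots> < ennreal \<epsilon>"
      using small a(1) \<open>a < \<epsilon>\<close> by (intro ennreal_lessI) auto
    finally show "qnorm \<omega> m n (\<lambda>x. (f \<star> g) x - h x) < ennreal \<epsilon>" .
  qed
qed

theorem theorem3p9:
  fixes \<omega> :: "real \<Rightarrow> real"
  assumes "nonquasianalytic_weight \<omega>"
  shows "(\<forall>f\<in>S_space \<omega>. \<forall>g\<in>S_space \<omega>. (f \<star> g :: real ^ 'n::finite \<Rightarrow> complex) \<in> S_space \<omega>) \<and>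
    bilinear_on (S_space \<omega> :: (real ^ 'n \<Rightarrow> complex) set) (\<star>) \<and>
    continuous_map
      (prod_topology (S_topology \<omega> :: (real ^ 'n \<Rightarrow> complex) topology) (S_topology \<omega>))
      (S_topology \<omega>) (\<lambda>(f, g). f \<star> g)"
proof (intro conjI ballI)
  let ?T = "S_topology \<omega> :: (real ^ 'n \<Rightarrow> complex) topology"
  let ?S = "S_space \<omega> :: (real ^ 'n \<Rightarrow> complex) set"
  let ?ball = "\<lambda>h m n \<epsilon>. {g \<in> ?S. qnorm \<omega> m n (\<lambda>x. g x - h x) < ennreal \<epsilon>}"
  let ?conv = "\<lambda>(f, g). f \<star> g :: real ^ 'n \<Rightarrow> complex"
  show closed: "f \<star> g \<in> ?S" if "f \<in> ?S" "g \<in> ?S" for f g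
    by (rule S_space_convolution[OF assms that])
  show "bilinear_on ?S (\<star>)"
    by (rule bilinear_convolution[OF assms])
  \<comment> \<open>For a generated topology it suffices that preimages of subbasic balls are open.
    Around each point of such a preimage a product of two balls, with the same \<open>m\<close> but
    a larger decay index allowed, fits inside.\<close>
  have "openin (prod_topology ?T ?T) (?conv -` ?ball h m n \<epsilon> \<inter> topspace (prod_topology ?T ?T))"
    if h: "h \<in> ?S" and mn: "1 \<le> m" "1 \<le> n" for h m n \<epsilon>
    unfolding openin_prod_topology_alt
  proof (intro allI impI)
    fix f0 g0
    assume "(f0, g0) \<in> ?conv -` ?ball h m n \<epsilon> \<inter> topspace (prod_topology ?T ?T)"
    then have S: "f0 \<in> ?S" "g0 \<in> ?S"
      and less: "qnorm \<omega> m n (\<lambda>x. (f0 \<star> g0) x - h x) < ennreal \<epsilon>"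
      by (auto simp: topspace_S_topology)
    then have r: "rapid \<omega> f0" "rapid \<omega> g0" "rapid \<omega> h"
      using h by (auto simp: S_space_iff)
    obtain N \<delta> where N: "N \<ge> 1" "\<delta> > 0"
      "\<And>f g. rapid \<omega> f \<Longrightarrow> rapid \<omega> g \<Longrightarrow> qnorm \<omega> m N (\<lambda>x. f x - f0 x) < ennreal \<delta> \<Longrightarrow>
        qnorm \<omega> m N (\<lambda>x. g x - g0 x) < ennreal \<delta> \<Longrightarrow>
        qnorm \<omega> m n (\<lambda>x. (f \<star> g) x - h x) < ennreal \<epsilon>"
      using qnorm_convolution_continuous_at[OF assms mn(2) r less] by blast
    show "\<exists>U V. openin ?T U \<and> openin ?T V \<and> f0 \<in> U \<and> g0 \<in> V \<and>
        U \<times> V \<subseteq> ?conv -` ?ball h m n \<epsilon> \<inter> topspace (prod_topology ?T ?T)"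
    proof (intro exI conjI)
      show "openin ?T (?ball f0 m N \<delta>)" "openin ?T (?ball g0 m N \<delta>)"
        by (intro openin_S_topology_ball S mn N)+
      show "f0 \<in> ?ball f0 m N \<delta>" "g0 \<in> ?ball g0 m N \<delta>"
        using S N(2) by (simp_all only: mem_Collect_eq qnorm_self) simp_all
      show "?ball f0 m N \<delta> \<times> ?ball g0 m N \<delta> \<subseteq>
          ?conv -` ?ball h m n \<epsilon> \<inter> topspace (prod_topology ?T ?T)"
        using closed N(3) by (auto simp: topspace_S_topology S_space_iff)
    qed
  qed
  then have pre: "openin (prod_topology ?T ?T) (?conv -` U \<inter> topspace (prod_topology ?T ?T))"
    if "U \<in> {?ball h m n \<epsilon> | h m n \<epsilon>. h \<in> ?S \<and> 1 \<le> m \<and> 1 \<le> n \<and> 0 < \<epsilon>}" for U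
    using that by blast
  have "?conv ` topspace (prod_topology ?T ?T) \<subseteq> topspace ?T"
    using closed by (auto simp: topspace_S_topology)
  then show "continuous_map (prod_topology ?T ?T) ?T ?conv"
    unfolding S_topology_def[where 'n = 'n, of \<omega>] continuous_on_generated_topo_iff
      topology_generated_by_topspace
    using pre unfolding S_topology_def[where 'n = 'n, of \<omega>] by blast
qed

end
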